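(* Let $n>p+1>2$, let $h=\lceil (n+p+1)/2\rceil$, and let $\pmb X$ be a data set of $n$ observations in general position in $\mathbb{R}^p$. Then the finite sample breakdown point of the PCS scatter estimator $\pmb S^*$ at $\pmb X$ is $$\varepsilon_n^*(\pmb S^*,\pmb X)=\frac{n-h+1}{n}.$$
   Context: **Data and contamination.** $\pmb X$ is an $n\times p$ real data matrix of genuine observations $\pmb x_1,\dots,\pmb x_n\in\mathbb{R}^p$. It is in general position in $\mathbb{R}^p$ if no more than $p$ points of $\pmb X$ lie in any $(p-1)$-dimensional affine subspace (so any $p+1$ points determine a $p$-simplex with non-zero determinant). Standing assumptions on $\pmb X$: $\sup_{\pmb a\in\mathbb{R}^p,\,\pmb a\neq 0}\max_i (\pmb x_i'\pmb a/\|\pmb a\|)^2$ is bounded, and $\|\pmb x_i-\pmb x_j\|>0$ for all $1\leqslant i<j\leqslant n$. For an integer $c$ with $1\leqslant c\leqslant n$, let $\varepsilon=c/n$ and $g=n-c$. A corrupted data set $\pmb X^{\varepsilon}$ is an $n\times p$ matrix with rows $\pmb x_i^\varepsilon$ consisting of $g$ observations from $\pmb X$ and $c$ arbitrary vectors of $\mathbb{R}^p$ (the genuine rows are arranged to be the first $g$ rows and the contaminated ones the last $c$ rows). $\mathcal{X}^{\varepsilon}$ is the set of all such corrupted data sets. **PCS estimators.** Let $\pmb X$ here denote any (possibly contaminated) data set with rows $\pmb x_1,\dots,\pmb x_n\in\mathbb{R}^p$. An $h$-subset is a subset of $\{1,\dots,n\}$ of size $h$; there are $M=\binom nh$ of them,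 $H^1,\dots,H^M$. For an $h$-subset $H^m$, $B(H^m)$ is the set of all vectors $\pmb a$ normal to hyperplanes spanned by a $p$-subset of $H^m$, i.e. such that the hyperplane $\{\pmb x\in\mathbb{R}^p:\pmb x'\pmb a=1\}$ contains $p$ observations with index in $H^m$. Put $d_i^2(\pmb a)=(\pmb a'\pmb x_i-1)^2/\|\pmb a\|^2$, let $d_{(h)}^2(\pmb a)$ be the $h$-th order statistic (in increasing order) of $d_1^2(\pmb a),\dots,d_n^2(\pmb a)$, and let $H^{\pmb a}=\{i: d_i^2(\pmb a)\leqslant d_{(h)}^2(\pmb a)\}$. The incongruence index of $H^m$ along $\pmb a$ is $$I(H^m,\pmb a)=\log\left(\frac{\mathrm{ave}_{i\in H^m} d_i^2(\pmb a)}{\mathrm{ave}_{i\in H^{\pmb a}} d_i^2(\pmb a)}\right),\qquad \log(0/0):=0,$$ where $\mathrm{ave}$ denotes the arithmetic mean, and $I(H^m)=\mathrm{ave}_{\pmb a\in B(H^m)} I(H^m,\pmb a)$. The optimal subset is $H^*=\arg\min_{\{H^m\}_{m=1}^M} I(H^m)$. Special case: if there is $\pmb a^*\in B(H^* )$ with $|\{i:d_i^2(\pmb a^* )=0\}|\geqslant h$, then $H^*$ is replaced by $\{i:d_i^2(\pmb a^* )=0\}$. The PCS estimators of location and scatter are the sample mean and sample covariance over $H^*$: $\pmb t^*(\pmb X)=\mathrm{ave}_{i\in H^*}\pmb x_i$ and $\pmb S^*(\pmb X)=\mathrm{ave}_{i\in H^*}(\pmb x_i-\pmb t^* )(\pmb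 x_i-\pmb t^* )'$. **Breakdown point of scatter.** For an affine equivariant scatter estimator $\pmb S$ with $\pmb S(\pmb X)$ positive definite, $$\mathrm{bias}(\pmb S,\pmb X,\varepsilon)=\sup_{\pmb X^\varepsilon\in\mathcal{X}^\varepsilon}\frac{\lambda_1(\pmb Q^\varepsilon)}{\lambda_p(\pmb Q^\varepsilon)},\qquad \pmb Q^\varepsilon=\pmb S(\pmb X)^{-1/2}\,\pmb S(\pmb X^\varepsilon)\,\pmb S(\pmb X)^{-1/2},$$ where $\lambda_1$ and $\lambda_p$ denote the largest and smallest eigenvalues and the ratio is read as $+\infty$ when $\lambda_p(\pmb Q^\varepsilon)=0$. The finite sample breakdown point is $$\varepsilon_n^*(\pmb S,\pmb X)=\min_{1\leqslant c\leqslant n}\left\{\varepsilon=\frac cn:\ \mathrm{bias}(\pmb S,\pmb X,\varepsilon)=\infty\right\}.$$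
   Formalization: B(H) is taken as all hyperplanes spanned by p-subsets of H, including those through the origin, which have no equation x'a=1; with only hyperplanes x'a=1 the estimator is not affine equivariant and the claim fails, e.g. for some X containing the origin with p=2, n=5. *)

theory Defs
  imports "HOL-Analysis.Analysis" "HOL-Library.Multiset"
begin

(* A data set is the list of its rows, points of real ^ 'p with p = CARD('p).
   Observations are addressed by their positions 0, ..., n - 1, so repeated rows
   (possible after contamination) count as different observations. *)

definition general_position :: "(real ^ 'p) list \<Rightarrow> bool" where
  "general_position X \<longleftrightarrow>
     (\<forall>A. affine A \<and> aff_dim A = int CARD('p) - 1 \<longrightarrow> card {i. i < length X \<and> X ! i \<in> A} \<le> CARD('p))"

definition ave :: "('i \<Rightarrow> 'v :: real_vector) \<Rightarrow> 'i set \<Rightarrow> 'v" where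
  "ave f A = sum f A /\<^sub>R real (card A)"


subsection \<open>The PCS estimator of scatter\<close>

definition h_subsets :: "nat \<Rightarrow> nat \<Rightarrow> nat set set" where
  "h_subsets n h = {H. H \<subseteq> {..<n} \<and> card H = h}"

(* The directions B(H), one for each hyperplane spanned by a p-subset of H. A hyperplane
   missing the origin is {x. x \<bullet> a = 1} for exactly one normal a, and such hyperplanes are
   identified with these vectors a (normals_eq_hyperplanes below). Hyperplanes through the
   origin have no equation of this form; keeping the hyperplane itself, rather than a,
   makes the incongruence index affine invariant. Position sets whose points span less than a
   hyperplane contribute nothing. *)
definition hyperplanes :: "(real ^ 'p) list \<Rightarrow> nat set \<Rightarrow> (real ^ 'p) set set" where
  "hyperplanes X H =
     {affine hull ((!) X ` J) | J.
        J \<subseteq> H \<and> card J = CARD('p) \<and> aff_dim ((!) X ` J) = int CARD('p) - 1}"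

(* Squared orthogonal distance to P; for P = {x. x \<bullet> a = 1} it is
   (a \<bullet> x - 1)^2 / (norm a)^2, see sq_dist_hyperplane below. *)
definition sq_dist :: "(real ^ 'p) set \<Rightarrow> real ^ 'p \<Rightarrow> real" where
  "sq_dist P x = (infdist x P)\<^sup>2"

definition order_stat :: "nat \<Rightarrow> real list \<Rightarrow> real" where
  "order_stat h ds = sort ds ! (h - 1)"

definition closest :: "nat \<Rightarrow> (real ^ 'p) list \<Rightarrow> (real ^ 'p) set \<Rightarrow> nat set" where
  "closest h X P =
     {i. i < length X \<and> sq_dist P (X ! i) \<le> order_stat h (map (sq_dist P) X)}"

(* log(u / v) for u, v >= 0, with log(0/0) = 0 and log(u/0) = \<infinity> for u > 0.
   The case u = 0 < v, where the value should be -\<infinity>, does not occur in incongruence_along. *)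
definition log_ratio :: "real \<Rightarrow> real \<Rightarrow> ereal" where
  "log_ratio u v =
     (if u = 0 \<and> v = 0 then 0 else if v = 0 then \<infinity> else if u = 0 then -\<infinity> else ereal (ln (u / v)))"

definition incongruence_along ::
  "nat \<Rightarrow> (real ^ 'p) list \<Rightarrow> nat set \<Rightarrow> (real ^ 'p) set \<Rightarrow> ereal" where
  "incongruence_along h X H P =
     log_ratio (ave (\<lambda>i. sq_dist P (X ! i)) H) (ave (\<lambda>i. sq_dist P (X ! i)) (closest h X P))"

(* If H spans no hyperplane, the empty average is 0 / 0 = 0 in ereal. *)
definition incongruence :: "nat \<Rightarrow> (real ^ 'p) list \<Rightarrow> nat set \<Rightarrow> ereal" where
  "incongruence h X H =
     (\<Sum>P\<in>hyperplanes X H. incongruence_along h X H P) / ereal (card (hyperplanes X H))"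

definition on_hyperplane :: "(real ^ 'p) list \<Rightarrow> (real ^ 'p) set \<Rightarrow> nat set" where
  "on_hyperplane X P = {i. i < length X \<and> sq_dist P (X ! i) = 0}"

(* The possible values of H^*: neither the minimiser of the incongruence index nor the
   hyperplane in the exact-fit case need be unique, and every choice is admitted. *)
definition pcs_subset :: "nat \<Rightarrow> (real ^ 'p) list \<Rightarrow> nat set \<Rightarrow> bool" where
  "pcs_subset h X H \<longleftrightarrow>
     (\<exists>H\<^sub>0. is_arg_min (incongruence h X) (\<lambda>H. H \<in> h_subsets (length X) h) H\<^sub>0 \<and>
        (let F = {P \<in> hyperplanes X H\<^sub>0. card (on_hyperplane X P) \<ge> h} in
         if F = {} then H = H\<^sub>0 else H \<in> on_hyperplane X ` F))"

definition scatter :: "(real ^ 'p) list \<Rightarrow> nat set \<Rightarrow> real ^ 'p ^ 'p" where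
  "scatter X H =
     (let t = ave (\<lambda>i. X ! i) H
      in ave (\<lambda>i. \<chi> j k. (X ! i - t) $ j * (X ! i - t) $ k) H)"

(* S is the PCS estimator of scatter on data sets of size n, for some way of breaking ties. *)
definition pcs_scatter :: "nat \<Rightarrow> nat \<Rightarrow> ((real ^ 'p) list \<Rightarrow> real ^ 'p ^ 'p) \<Rightarrow> bool" where
  "pcs_scatter n h S \<longleftrightarrow>
     (\<forall>X. length X = n \<longrightarrow> (\<exists>H. pcs_subset h X H \<and> S X = scatter X H))"


subsection \<open>The finite sample breakdown point of a scatter estimator\<close>

definition corrupted :: "(real ^ 'p) list \<Rightarrow> nat \<Rightarrow> (real ^ 'p) list set" where
  "corrupted X c =
     {G @ C | G C. mset G \<subseteq># mset X \<and> length G = length X - c \<and> length C = c}"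

definition pos_def :: "real ^ 'p ^ 'p \<Rightarrow> bool" where
  "pos_def A \<longleftrightarrow> transpose A = A \<and> (\<forall>v. v \<noteq> 0 \<longrightarrow> v \<bullet> (A *v v) > 0)"

(* A^(-1/2); only meaningful for positive definite A. *)
definition inv_sqrt :: "real ^ 'p ^ 'p \<Rightarrow> real ^ 'p ^ 'p" where
  "inv_sqrt A = (THE R. pos_def R \<and> R ** R = matrix_inv A)"

definition eigenvalues :: "real ^ 'p ^ 'p \<Rightarrow> real set" where
  "eigenvalues A = {l. \<exists>v. v \<noteq> 0 \<and> A *v v = l *\<^sub>R v}"

definition eigen_ratio :: "real ^ 'p ^ 'p \<Rightarrow> ereal" where
  "eigen_ratio Q =
     (if Min (eigenvalues Q) = 0 then \<infinity>
      else ereal (Max (eigenvalues Q) / Min (eigenvalues Q)))"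

(* The bias at contamination level c / n. *)
definition bias :: "((real ^ 'p) list \<Rightarrow> real ^ 'p ^ 'p) \<Rightarrow> (real ^ 'p) list \<Rightarrow> nat \<Rightarrow> ereal" where
  "bias S X c = (SUP Y\<in>corrupted X c. eigen_ratio (inv_sqrt (S X) ** S Y ** inv_sqrt (S X)))"

definition breakdown_point :: "((real ^ 'p) list \<Rightarrow> real ^ 'p ^ 'p) \<Rightarrow> (real ^ 'p) list \<Rightarrow> real" where
  "breakdown_point S X =
     Min {real c / real (length X) | c. 1 \<le> c \<and> c \<le> length X \<and> bias S X c = \<infinity>}"


subsection \<open>Checks of the definitions\<close>

lemma sq_dist_hyperplane:
  fixes a :: "real ^ 'p"
  assumes "a \<noteq> 0"
  shows "sq_dist {x. x \<bullet> a = b} y = (a \<bullet> y - b)\<^sup>2 / (norm a)\<^sup>2"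
proof -
  let ?P = "{x. x \<bullet> a = b}"
  define s where "s = (a \<bullet> y - b) / (a \<bullet> a)"
  define z where "z = y - s *\<^sub>R a"
  have aa: "a \<bullet> a \<noteq> 0" using assms by simp
  have z: "z \<in> ?P" using aa by (simp add: z_def s_def inner_diff_left inner_commute[of y a])
  have d: "dist y z = \<bar>a \<bullet> y - b\<bar> / norm a"
    using assms by (simp add: z_def s_def dist_norm dot_square_norm power2_eq_square)
  have le: "\<bar>a \<bullet> y - b\<bar> / norm a \<le> dist y x" if "x \<in> ?P" for x
  proof -
    have "a \<bullet> y - b = a \<bullet> (y - x)"
      using that by (simp add: inner_diff_right inner_commute)
    then have "\<bar>a \<bullet> y - b\<bar> \<le> norm a * dist y x"
      by (simp add: dist_norm Cauchy_Schwarz_ineq2)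
    then show ?thesis using assms by (simp add: field_simps)
  qed
  have "infdist y ?P = \<bar>a \<bullet> y - b\<bar> / norm a"
  proof (rule antisym)
    show "infdist y ?P \<le> \<bar>a \<bullet> y - b\<bar> / norm a" using infdist_le[OF z, of y] d by simp
    show "\<bar>a \<bullet> y - b\<bar> / norm a \<le> infdist y ?P"
      using z le by (subst infdist_notempty) (auto intro: cINF_greatest)
  qed
  then show ?thesis by (simp add: sq_dist_def power_divide)
qed

lemma affine_hull_eq_hyperplane:
  fixes T :: "(real ^ 'p) set"
  assumes "aff_dim T = int CARD('p) - 1" "a \<noteq> 0" "\<And>x. x \<in> T \<Longrightarrow> x \<bullet> a = b"
  shows "affine hull T = {x. x \<bullet> a = b}"
proof -
  have eq: "{x. x \<bullet> a = b} = {x. a \<bullet> x = b}" by (simp add: inner_commute)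
  have aff: "affine {x. x \<bullet> a = b}" unfolding eq by (rule affine_hyperplane)
  have sub: "affine hull T \<subseteq> {x. x \<bullet> a = b}"
    using assms(3) aff by (intro hull_minimal) auto
  have "aff_dim {x. x \<bullet> a = b} = aff_dim (affine hull T)"
    unfolding eq using assms(1,2) by simp
  moreover have "affine hull T \<noteq> {}"
  proof
    assume "affine hull T = {}"
    then have "aff_dim T = -1" by simp
    then show False using assms(1) by simp
  qed
  ultimately show ?thesis
    using sub aff affine_affine_hull affine_independent_span_eq aff_dim_eq_full_gen
    by (metis affine_dim_equal aff_dim_affine_hull)
qed

lemma normals_eq_hyperplanes:
  fixes X :: "(real ^ 'p) list" and H :: "nat set"
  defines "B \<equiv> {a. \<exists>J\<subseteq>H. card J = CARD('p) \<and> aff_dim ((!) X ` J) = int CARD('p) - 1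
                    \<and> (\<forall>i\<in>J. X ! i \<bullet> a = 1)}"
  shows "bij_betw (\<lambda>a. {x. x \<bullet> a = 1}) B {P \<in> hyperplanes X H. 0 \<notin> P}"
proof -
  have nz: "a \<noteq> 0" if "a \<in> B" for a
  proof
    assume "a = 0"
    with that obtain J where "card J = CARD('p)" "\<forall>i\<in>J. X ! i \<bullet> a = 1"
      unfolding B_def by auto
    then show False using \<open>a = 0\<close> by (cases "J = {}") auto
  qed
  have inj: "a = a'" if "{x. x \<bullet> a = 1} = {x. x \<bullet> a' = 1}" "a \<noteq> 0" "a' \<noteq> 0" for a a' :: "real ^ 'p"
  proof -
    have *: "z \<bullet> a = z \<bullet> a'" if "z \<bullet> a' \<noteq> 0" for z
    proof -
      have "(z /\<^sub>R (z \<bullet> a')) \<bullet> a' = 1" using that by simp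
      then have "(z /\<^sub>R (z \<bullet> a')) \<bullet> a = 1" using \<open>{x. x \<bullet> a = 1} = _\<close> by blast
      then show ?thesis using that by (simp add: field_simps)
    qed
    have "z \<bullet> a = z \<bullet> a'" for z
    proof (cases "z \<bullet> a' = 0")
      case True
      have "a' \<bullet> a = a' \<bullet> a'" using \<open>a' \<noteq> 0\<close> by (intro *) simp
      moreover have "(z + a') \<bullet> a = (z + a') \<bullet> a'"
        using \<open>a' \<noteq> 0\<close> True by (intro *) (simp add: inner_add_left)
      ultimately show ?thesis by (simp add: inner_add_left)
    qed (rule *)
    then show ?thesis by (metis inner_commute vector_eq_ldot)
  qed
  have "(\<lambda>a. {x. x \<bullet> a = 1}) ` B = {P \<in> hyperplanes X H. 0 \<notin> P}" (is "?L = ?R")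
  proof
    show "?L \<subseteq> ?R"
    proof
      fix P assume "P \<in> ?L"
      then obtain a J where a: "a \<in> B" "P = {x. x \<bullet> a = 1}"
        and J: "J \<subseteq> H" "card J = CARD('p)" "aff_dim ((!) X ` J) = int CARD('p) - 1"
          "\<forall>i\<in>J. X ! i \<bullet> a = 1" unfolding B_def by auto
      have "affine hull ((!) X ` J) = P"
        unfolding a(2) using J nz[OF a(1)] by (intro affine_hull_eq_hyperplane) auto
      then show "P \<in> ?R" using J a unfolding hyperplanes_def by auto
    qed
    show "?R \<subseteq> ?L"
    proof
      fix P assume "P \<in> ?R"
      then obtain J where P: "P = affine hull ((!) X ` J)" "0 \<notin> P"
        and J: "J \<subseteq> H" "card J = CARD('p)" "aff_dim ((!) X ` J) = int CARD('p) - 1"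
        unfolding hyperplanes_def by auto
      obtain a b where ab: "a \<noteq> 0" "(!) X ` J \<subseteq> {x. a \<bullet> x = b}"
        using aff_lowdim_subset_hyperplane[of "(!) X ` J"] J(3) by auto
      have Pe: "P = {x. x \<bullet> a = b}"
        unfolding P(1) using ab J(3)
        by (intro affine_hull_eq_hyperplane) (auto simp: inner_commute)
      then have b: "b \<noteq> 0" using P(2) by auto
      have "P = {x. x \<bullet> (a /\<^sub>R b) = 1}" unfolding Pe using b by (auto simp: field_simps)
      moreover have "a /\<^sub>R b \<in> B"
        unfolding B_def using J ab(2) b
        by (auto intro!: exI[of _ J] simp: inner_commute field_simps)
      ultimately show "P \<in> ?L" by blast
    qed
  qed
  moreover have "inj_on (\<lambda>a. {x. x \<bullet> a = 1}) B" using inj nz by (auto intro!: inj_onI)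
  ultimately show ?thesis by (simp add: bij_betw_def)
qed

lemma ex_pcs_subset:
  assumes "h \<le> length X"
  shows "\<exists>H. pcs_subset h X H"
proof -
  have fin: "finite (h_subsets (length X) h)"
    by (rule finite_subset[of _ "Pow {..<length X}"]) (auto simp: h_subsets_def)
  have "{..<h} \<in> h_subsets (length X) h" using assms by (auto simp: h_subsets_def)
  with fin obtain H\<^sub>0 where
    "is_arg_min (incongruence h X) (\<lambda>H. H \<in> h_subsets (length X) h) H\<^sub>0"
    using ex_is_arg_min_if_finite[of "h_subsets (length X) h" "incongruence h X"] by auto
  then show ?thesis
  proof (cases "{P \<in> hyperplanes X H\<^sub>0. card (on_hyperplane X P) \<ge> h} = {}")
    case True
    then have "pcs_subset h X H\<^sub>0"
      unfolding pcs_subset_def Let_def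
      using \<open>is_arg_min _ _ H\<^sub>0\<close> by (intro exI[of _ H\<^sub>0]) simp
    then show ?thesis ..
  next
    case False
    then obtain P where "P \<in> {P \<in> hyperplanes X H\<^sub>0. card (on_hyperplane X P) \<ge> h}"
      by blast
    then have "pcs_subset h X (on_hyperplane X P)"
      unfolding pcs_subset_def Let_def
      using \<open>is_arg_min _ _ H\<^sub>0\<close> False by (intro exI[of _ H\<^sub>0]) auto
    then show ?thesis ..
  qed
qed

lemma ex_pcs_scatter:
  assumes "h \<le> n"
  shows "\<exists>S :: (real ^ 'p) list \<Rightarrow> real ^ 'p ^ 'p. pcs_scatter n h S"
proof -
  have "pcs_scatter n h (\<lambda>X :: (real ^ 'p) list. scatter X (SOME H. pcs_subset h X H))"
    unfolding pcs_scatter_def using assms ex_pcs_subset by (metis someI_ex)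
  then show ?thesis by blast
qed

end

theory Submission
  imports Defs
begin

text \<open>
  If at most \<open>n - h\<close> rows are contaminated, every \<open>h\<close>-subset contains at least \<open>p + 1\<close> genuine
  points, since \<open>2 h > n + p\<close>. As these lie in no common hyperplane, the covariance of the subset
  is uniformly positive definite, and an exact fit cannot occur. A subset of
  genuine points has bounded incongruence index, hence so has the minimiser. By barycentric
  coordinates, a remote point in the minimiser would be far from some facet of a simplex of
  \<open>p + 1\<close> genuine points of the minimiser, which would make the index along that facet, and with
  it the average, large. So the minimiser stays in a fixed ball and the bias is finite.

  With \<open>n - h + 1\<close> contaminated rows, all at the same remote point, every admissible subset
  contains a genuine and a contaminated row, and its covariance degenerates in shape.
\<close>

subsection \<open>Symmetric matrices\<close>

text \<open>The index averages over all hyperplanes spanned by the subset, and those through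
  contaminated rows are beyond control: a huge term along one facet could a priori be offset by very
  negative terms elsewhere. Two crude facts exclude this: every term is at least
  \<open>- ln h\<close>, and there are at most \<open>2 ^ h\<close> hyperplanes. So an average of at
  most \<open>L\<close> limits each term to \<open>2 ^ h * (L + ln h)\<close>. Along a facet of
  genuine points the denominator is bounded as well, since \<open>h\<close> genuine rows keep the
  \<open>h\<close>-th smallest distance bounded wherever the other rows lie.

  The supremum in \<open>bias\<close> asks for constants chosen before the corrupted sample. They
  come from extrema over finitely many configurations of genuine points.

  Eigenvalue ratios are reached only through bounds on quadratic forms. But \<open>inv_sqrt\<close>
  is a definite description and \<open>eigen_ratio\<close> takes \<open>Min\<close> and
  \<open>Max\<close> of a set, so unique square roots and finite spectra come first.\<close>

lemma symmetric_inner: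
  fixes A :: "real ^ 'n ^ 'n"
  assumes "transpose A = A"
  shows "(A *v x) \<bullet> y = x \<bullet> (A *v y)"
  by (metis assms dot_lmul_matrix transpose_matrix_vector)

section \<open>Quadratic forms and extreme eigenvalues\<close>

text \<open>The first-order condition at an extremum, for a function whose increment along a line is
  quadratic in \<open>t\<close>.\<close>

lemma quadratic_nonneg_linear_coeff:
  fixes a b :: real
  assumes "\<And>t. 0 \<le> 2 * t * a + t\<^sup>2 * b"
  shows "a = 0"
proof (rule ccontr)
  assume "a \<noteq> 0"
  define s where "s = 1 / (\<bar>b\<bar> + 1)"
  have s: "s > 0" "s * b < 1" by (auto simp: s_def divide_simps)
  have "0 \<le> 2 * (- s * a) * a + (- s * a)\<^sup>2 * b" by (rule assms)
  also have "\<dots> = s * a\<^sup>2 * (s * b - 2)" by (simp add: power2_eq_square algebra_simps)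
  also have "\<dots> < 0" using s \<open>a \<noteq> 0\<close> by (intro mult_pos_neg) auto
  finally show False by simp
qed

text \<open>A maximiser of the form on the unit sphere of \<open>V\<close> is an eigenvector, by the
  first-order condition. An arbitrary invariant \<open>V\<close> serves both the extreme eigenvalues
  on the whole space and the extension of an eigenbasis into its orthogonal complement.\<close>

lemma symmetric_eigenvector_in_subspace:
  fixes A :: "real ^ 'n ^ 'n"
  assumes A: "transpose A = A" and V: "subspace V" "V \<noteq> {0}" "\<And>v. v \<in> V \<Longrightarrow> A *v v \<in> V"
  obtains v l where "v \<in> V" "norm v = 1" "A *v v = l *\<^sub>R v"
    "\<And>w. w \<in> V \<Longrightarrow> w \<bullet> (A *v w) \<le> l * (w \<bullet> w)"
proof -
  let ?S = "sphere 0 1 \<inter> V"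
  have "compact ?S" using closed_subspace[OF V(1)] by (simp add: compact_Int_closed)
  moreover have "?S \<noteq> {}"
  proof -
    have "0 \<in> V" using V(1) by (rule subspace_0)
    with V(2) obtain z where "z \<in> V" "z \<noteq> 0" by auto
    then have "z /\<^sub>R norm z \<in> ?S" using subspace_scale[OF V(1)] by simp
    then show ?thesis by blast
  qed
  moreover have "continuous_on ?S (\<lambda>v. v \<bullet> (A *v v))"
    by (intro continuous_intros linear_continuous_on matrix_vector_mul_bounded_linear)
  ultimately obtain v where v: "v \<in> ?S" and vmax: "\<And>w. w \<in> ?S \<Longrightarrow> w \<bullet> (A *v w) \<le> v \<bullet> (A *v v)"
    using continuous_attains_sup[of ?S "\<lambda>v. v \<bullet> (A *v v)"] by blast
  define l where "l = v \<bullet> (A *v v)"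
  have vv: "v \<bullet> v = 1" using v by (simp add: dot_square_norm)
  have le: "w \<bullet> (A *v w) \<le> l * (w \<bullet> w)" if "w \<in> V" for w
  proof (cases "w = 0")
    case False
    have "w /\<^sub>R norm w \<in> ?S" using that subspace_scale[OF V(1)] False by simp
    from vmax[OF this] False show ?thesis
      by (simp add: l_def matrix_vector_mult_scaleR dot_square_norm power2_eq_square divide_simps)
  qed simp
  \<comment> \<open>Perturbing along the residual itself makes the linear coefficient equal to
    \<open>u \<bullet> u\<close>; invariance keeps \<open>u\<close> in \<open>V\<close>.\<close>
  define u where "u = l *\<^sub>R v - A *v v"
  have uV: "u \<in> V" using V(3) v subspace_diff[OF V(1)] subspace_scale[OF V(1)] by (simp add: u_def)
  have "0 \<le> 2 * t * (u \<bullet> u) + t\<^sup>2 * (l * (u \<bullet> u) - u \<bullet> (A *v u))" for t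
  proof -
    have "v + t *\<^sub>R u \<in> V" using uV v subspace_add[OF V(1)] subspace_scale[OF V(1)] by simp
    from le[OF this]
    have "0 \<le> l * ((v + t *\<^sub>R u) \<bullet> (v + t *\<^sub>R u)) - (v + t *\<^sub>R u) \<bullet> (A *v (v + t *\<^sub>R u))" by simp
    also have "\<dots> = (l * (v \<bullet> v) - l) + 2 * t * (l * (u \<bullet> v) - u \<bullet> (A *v v))
        + t\<^sup>2 * (l * (u \<bullet> u) - u \<bullet> (A *v u))"
      using symmetric_inner[OF A, of v u]
      by (simp add: l_def inner_add_left inner_add_right matrix_vector_mult_scaleR
          matrix_vector_right_distrib power2_eq_square algebra_simps inner_commute)
    also have "l * (u \<bullet> v) - u \<bullet> (A *v v) = u \<bullet> u" by (simp add: u_def inner_diff_right inner_diff_left)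
    finally show ?thesis using vv by simp
  qed
  then have "u \<bullet> u = 0" by (rule quadratic_nonneg_linear_coeff)
  then have "A *v v = l *\<^sub>R v" by (simp add: u_def)
  then show ?thesis using that v le by auto
qed

lemma matrix_uminus_mult_vec: "(- A) *v x = - (A *v x)" for A :: "real ^ 'n ^ 'm"
  by (simp add: matrix_vector_mult_def vec_eq_iff sum_negf)

lemma transpose_uminus: "transpose (- A) = - transpose A" for A :: "real ^ 'n ^ 'm"
  by (simp add: transpose_def vec_eq_iff)

text \<open>Eigenvectors for different eigenvalues are orthogonal, hence independent, hence finitely
  many. This gives \<open>Min\<close> and \<open>Max\<close> in \<open>eigen_ratio\<close> their
  meaning.\<close>

lemma finite_eigenvalues_symmetric:
  fixes A :: "real ^ 'n ^ 'n"
  assumes A: "transpose A = A"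
  shows "finite (eigenvalues A)"
proof -
  have "\<forall>l\<in>eigenvalues A. \<exists>v. v \<noteq> 0 \<and> A *v v = l *\<^sub>R v" by (simp add: eigenvalues_def)
  then obtain f where f: "\<And>l. l \<in> eigenvalues A \<Longrightarrow> f l \<noteq> 0 \<and> A *v f l = l *\<^sub>R f l"
    by (auto dest!: bchoice)
  have orth: "f l \<bullet> f m = 0" if "l \<in> eigenvalues A" "m \<in> eigenvalues A" "l \<noteq> m" for l m
    using symmetric_inner[OF A, of "f l" "f m"] f[OF that(1)] f[OF that(2)] that(3) by simp
  have inj: "inj_on f (eigenvalues A)"
  proof (rule inj_onI, rule ccontr)
    fix l m assume "l \<in> eigenvalues A" "m \<in> eigenvalues A" "f l = f m" "l \<noteq> m"
    then show False using orth[of l m] f[of m] by simp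
  qed
  have "pairwise orthogonal (f ` eigenvalues A)"
    by (auto simp: pairwise_def orthogonal_def intro!: orth)
  moreover have "0 \<notin> f ` eigenvalues A" using f by auto
  ultimately have "independent (f ` eigenvalues A)" by (rule pairwise_orthogonal_independent)
  then have "finite (f ` eigenvalues A)" by (rule independent_imp_finite)
  then show ?thesis using inj finite_image_iff by blast
qed

lemma UNIV_vec_ne_singleton: "(UNIV :: (real ^ 'n) set) \<noteq> {0}"
  by (metis UNIV_I axis_eq_0_iff singletonD zero_neq_one)

lemma symmetric_Max_eigenvalue:
  fixes A :: "real ^ 'n ^ 'n"
  assumes A: "transpose A = A"
  shows "Max (eigenvalues A) \<in> eigenvalues A" "w \<bullet> (A *v w) \<le> Max (eigenvalues A) * (w \<bullet> w)"
proof -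
  obtain v l where vl: "norm v = 1" "A *v v = l *\<^sub>R v" "\<And>w. w \<bullet> (A *v w) \<le> l * (w \<bullet> w)"
    using symmetric_eigenvector_in_subspace[OF A subspace_UNIV UNIV_vec_ne_singleton] by auto
  then have "v \<noteq> 0" by auto
  then have l: "l \<in> eigenvalues A" unfolding eigenvalues_def using vl(2) by blast
  then show "Max (eigenvalues A) \<in> eigenvalues A"
    using Max_in[OF finite_eigenvalues_symmetric[OF A]] by auto
  have "l \<le> Max (eigenvalues A)" using l by (simp add: finite_eigenvalues_symmetric[OF A])
  then show "w \<bullet> (A *v w) \<le> Max (eigenvalues A) * (w \<bullet> w)"
    by (meson inner_ge_zero mult_right_mono order_trans vl(3))
qed

lemma symmetric_Min_eigenvalue:
  fixes A :: "real ^ 'n ^ 'n"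
  assumes A: "transpose A = A"
  shows "Min (eigenvalues A) \<in> eigenvalues A" "Min (eigenvalues A) * (w \<bullet> w) \<le> w \<bullet> (A *v w)"
proof -
  have "transpose (- A) = - A" by (simp add: transpose_uminus A)
  then obtain v l where vl: "norm v = 1" "- (A *v v) = l *\<^sub>R v" "\<And>w. - (w \<bullet> (A *v w)) \<le> l * (w \<bullet> w)"
    using symmetric_eigenvector_in_subspace[OF _ subspace_UNIV UNIV_vec_ne_singleton, of "- A"]
    by (auto simp: matrix_uminus_mult_vec)
  then have "A *v v = (- l) *\<^sub>R v" by (metis minus_minus scaleR_minus_left)
  moreover have "v \<noteq> 0" using vl(1) by auto
  ultimately have l: "- l \<in> eigenvalues A" unfolding eigenvalues_def by blast
  then show "Min (eigenvalues A) \<in> eigenvalues A"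
    using Min_in[OF finite_eigenvalues_symmetric[OF A]] by auto
  have "Min (eigenvalues A) \<le> - l" using l by (simp add: finite_eigenvalues_symmetric[OF A])
  then have "Min (eigenvalues A) * (w \<bullet> w) \<le> - l * (w \<bullet> w)" by (intro mult_right_mono) auto
  then show "Min (eigenvalues A) * (w \<bullet> w) \<le> w \<bullet> (A *v w)" using vl(3)[of w] by simp
qed

section \<open>Eigenvalue ratios from bounds on quadratic forms\<close>

lemma eigenvalue_quadratic_form:
  assumes "l \<in> eigenvalues A"
  obtains v where "v \<noteq> 0" "v \<bullet> (A *v v) = l * (v \<bullet> v)"
  using assms by (auto simp: eigenvalues_def)

lemma eigen_ratio_le:
  fixes A :: "real ^ 'n ^ 'n"
  assumes A: "transpose A = A" and "0 < a"
    and lo: "\<And>v. a * (v \<bullet> v) \<le> v \<bullet> (A *v v)" and up: "\<And>v. v \<bullet> (A *v v) \<le> b * (v \<bullet> v)"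
  shows "eigen_ratio A \<le> ereal (b / a)"
proof -
  have bnd: "a \<le> l \<and> l \<le> b" if l: "l \<in> eigenvalues A" for l
  proof -
    obtain v where "v \<noteq> 0" "v \<bullet> (A *v v) = l * (v \<bullet> v)" using l by (rule eigenvalue_quadratic_form)
    then show ?thesis using lo[of v] up[of v] by simp
  qed
  have "Max (eigenvalues A) \<le> b" "a \<le> Min (eigenvalues A)" "0 \<le> Max (eigenvalues A)"
    using bnd symmetric_Max_eigenvalue(1)[OF A] symmetric_Min_eigenvalue(1)[OF A] \<open>0 < a\<close> by fastforce+
  then show ?thesis using \<open>0 < a\<close> by (auto simp: eigen_ratio_def intro!: frac_le)
qed

text \<open>Two test vectors suffice. Semidefiniteness rules out a negative least eigenvalue, which
  would spoil the sign of the quotient; a zero one gives \<open>\<infinity>\<close> by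
  definition.\<close>

lemma eigen_ratio_ge:
  fixes A :: "real ^ 'n ^ 'n"
  assumes A: "transpose A = A" and psd: "\<And>v. 0 \<le> v \<bullet> (A *v v)"
    and u: "u \<noteq> 0" "a * (u \<bullet> u) \<le> u \<bullet> (A *v u)" and w: "w \<noteq> 0" "w \<bullet> (A *v w) \<le> b * (w \<bullet> w)"
    and "0 \<le> a"
  shows "ereal (a / b) \<le> eigen_ratio A"
proof (cases "Min (eigenvalues A) = 0")
  case False
  obtain v where "v \<noteq> 0" "v \<bullet> (A *v v) = Min (eigenvalues A) * (v \<bullet> v)"
    using symmetric_Min_eigenvalue(1)[OF A] by (rule eigenvalue_quadratic_form)
  then have "0 < Min (eigenvalues A)" using psd[of v] False inner_gt_zero_iff[of v]
    by (auto simp: zero_le_mult_iff simp del: inner_gt_zero_iff)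
  moreover have "a * (u \<bullet> u) \<le> Max (eigenvalues A) * (u \<bullet> u)"
    using symmetric_Max_eigenvalue(2)[OF A, of u] u(2) by linarith
  then have "a \<le> Max (eigenvalues A)" using u(1) by simp
  moreover have "Min (eigenvalues A) * (w \<bullet> w) \<le> b * (w \<bullet> w)"
    using symmetric_Min_eigenvalue(2)[OF A, of w] w(2) by linarith
  then have "Min (eigenvalues A) \<le> b" using w(1) by simp
  ultimately show ?thesis using \<open>0 \<le> a\<close> False by (auto simp: eigen_ratio_def intro!: frac_le)
qed (simp add: eigen_ratio_def)

section \<open>Orthonormal eigenbases and positive definite square roots\<close>

text \<open>A largest orthonormal set of eigenvectors must span: its orthogonal complement is
  invariant and, if nonzero, would contain one more eigenvector.\<close>

lemma symmetric_orthonormal_eigenbasis: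
  fixes A :: "real ^ 'n ^ 'n"
  assumes A: "transpose A = A"
  obtains B l where "finite B" "span B = UNIV" "\<And>b. b \<in> B \<Longrightarrow> b \<bullet> b = 1"
    "\<And>b c. b \<in> B \<Longrightarrow> c \<in> B \<Longrightarrow> b \<noteq> c \<Longrightarrow> b \<bullet> c = 0" "\<And>b. b \<in> B \<Longrightarrow> A *v b = l b *\<^sub>R b"
proof -
  define good where "good B \<longleftrightarrow> (\<forall>b\<in>B. norm b = 1 \<and> (\<exists>l. A *v b = l *\<^sub>R b)) \<and> pairwise orthogonal B"
    for B :: "(real ^ 'n) set"
  have ind: "independent B" if "good B" for B
    using that by (intro pairwise_orthogonal_independent) (auto simp: good_def)
  have bound: "card B \<le> DIM(real ^ 'n)" if "good B" for B
    using independent_card_le[OF ind[OF that]] .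
  have "good {}" by (simp add: good_def)
  then obtain B where B: "good B" and Bmax: "\<And>C. good C \<Longrightarrow> card C \<le> card B"
    using ex_has_greatest_nat[of good "{}" card "Suc DIM(real ^ 'n)"] bound
    by (meson le_imp_less_Suc)
  have finB: "finite B" using independent_imp_finite[OF ind[OF B]] .
  have "span B = UNIV"
  proof (rule ccontr)
    assume ne: "span B \<noteq> UNIV"
    define V where "V = {x. \<forall>b\<in>B. x \<bullet> b = 0}"
    have "subspace V" by (auto simp: V_def subspace_def inner_add_left)
    moreover have "V \<noteq> {0}"
    proof -
      have "span B \<subset> span UNIV" using ne by auto
      then obtain x where "x \<noteq> 0" "\<And>y. y \<in> span B \<Longrightarrow> orthogonal x y"
        using orthogonal_to_subspace_exists_gen by metis
      then have "x \<in> V" "x \<noteq> 0" by (auto simp: V_def orthogonal_def span_base)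
      then show ?thesis by blast
    qed
    moreover have "A *v v \<in> V" if "v \<in> V" for v
    proof -
      have "(A *v v) \<bullet> b = 0" if "b \<in> B" for b
      proof -
        obtain l where "A *v b = l *\<^sub>R b" using B \<open>b \<in> B\<close> by (auto simp: good_def)
        then show ?thesis using \<open>v \<in> V\<close> that symmetric_inner[OF A, of v b] by (simp add: V_def)
      qed
      then show ?thesis by (simp add: V_def)
    qed
    ultimately obtain v l where v: "v \<in> V" "norm v = 1" "A *v v = l *\<^sub>R v"
      using symmetric_eigenvector_in_subspace[OF A] by metis
    have "v \<notin> B" using v(1,2) by (auto simp: V_def)
    have "good (insert v B)"
      using B v by (auto simp: good_def pairwise_insert V_def orthogonal_def inner_commute)
    from Bmax[OF this] show False using \<open>v \<notin> B\<close> finB by simp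
  qed
  moreover obtain l where "\<And>b. b \<in> B \<Longrightarrow> A *v b = l b *\<^sub>R b"
    using B unfolding good_def by metis
  ultimately show ?thesis
    using that[of B l] B finB by (auto simp: good_def pairwise_def orthogonal_def norm_eq_1)
qed

lemma pos_def_sqrt_exists:
  fixes A :: "real ^ 'n ^ 'n"
  assumes "pos_def A"
  obtains R where "pos_def R" "R ** R = A"
proof -
  have A: "transpose A = A" using assms by (simp add: pos_def_def)
  obtain B l where B: "finite B" "span B = UNIV" "\<And>b. b \<in> B \<Longrightarrow> b \<bullet> b = 1"
    "\<And>b c. b \<in> B \<Longrightarrow> c \<in> B \<Longrightarrow> b \<noteq> c \<Longrightarrow> b \<bullet> c = 0" "\<And>b. b \<in> B \<Longrightarrow> A *v b = l b *\<^sub>R b"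
    using symmetric_orthonormal_eigenbasis[OF A] by metis
  have l: "0 < l b" if "b \<in> B" for b
  proof -
    have "b \<noteq> 0" using B(3)[OF that] by auto
    then have "0 < b \<bullet> (A *v b)" using assms by (simp add: pos_def_def)
    then show ?thesis using B(3,5) that by simp
  qed
  \<comment> \<open>The sum over \<open>b\<close> of \<open>sqrt (l b)\<close> times the orthogonal
    projection onto the line of \<open>b\<close>.\<close>
  define R :: "real ^ 'n ^ 'n" where "R = (\<chi> i j. \<Sum>b\<in>B. sqrt (l b) * (b $ i * b $ j))"
  have Rv: "R *v x = (\<Sum>b\<in>B. (sqrt (l b) * (b \<bullet> x)) *\<^sub>R b)" for x
  proof -
    have "(R *v x) $ i = (\<Sum>b\<in>B. (sqrt (l b) * (b \<bullet> x)) *\<^sub>R b) $ i" for i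
    proof -
      have "(R *v x) $ i = (\<Sum>j\<in>UNIV. \<Sum>b\<in>B. sqrt (l b) * (b $ i * b $ j) * x $ j)"
        by (simp add: matrix_vector_mult_def R_def sum_distrib_right)
      also have "\<dots> = (\<Sum>b\<in>B. \<Sum>j\<in>UNIV. sqrt (l b) * (b $ i * b $ j) * x $ j)" by (rule sum.swap)
      also have "\<dots> = (\<Sum>b\<in>B. (sqrt (l b) * (b \<bullet> x)) *\<^sub>R b) $ i"
        by (simp add: sum_component inner_vec_def sum_distrib_left sum_distrib_right mult_ac)
      finally show ?thesis .
    qed
    then show ?thesis by (simp add: vec_eq_iff)
  qed
  have Rb: "R *v b = sqrt (l b) *\<^sub>R b" if "b \<in> B" for b
  proof -
    have "R *v b = (\<Sum>c\<in>B. if c = b then sqrt (l b) *\<^sub>R b else 0)"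
      unfolding Rv using B(3,4) that by (intro sum.cong) auto
    then show ?thesis using B(1) that by simp
  qed
  have "(R ** R) *v x = A *v x" for x
  proof -
    have "(R ** R) *v b = A *v b" if "b \<in> B" for b
      using Rb[OF that] B(5)[OF that] l[OF that]
      by (simp add: matrix_vector_mul_assoc[symmetric] matrix_vector_mult_scaleR)
    then show ?thesis
      using linear_eq_on[OF matrix_vector_mul_linear[of "R ** R"] matrix_vector_mul_linear[of A], of x B] B(2)
      by auto
  qed
  then have "R ** R = A" by (simp add: matrix_eq)
  moreover have "pos_def R"
    unfolding pos_def_def
  proof (intro conjI allI impI)
    show "transpose R = R" by (simp add: R_def transpose_def vec_eq_iff mult_ac)
    fix x :: "real ^ 'n" assume "x \<noteq> 0"
    have "\<exists>b\<in>B. b \<bullet> x \<noteq> 0"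
    proof (rule ccontr)
      assume "\<not> ?thesis"
      then have "orthogonal x y" if "y \<in> B" for y
        using that by (simp add: orthogonal_def inner_commute[of x])
      then have "orthogonal x x" using B(2) orthogonal_to_span by blast
      with \<open>x \<noteq> 0\<close> show False by (simp add: orthogonal_def)
    qed
    then obtain b where "b \<in> B" "b \<bullet> x \<noteq> 0" by blast
    then have "0 < (\<Sum>b\<in>B. sqrt (l b) * (b \<bullet> x)\<^sup>2)"
      using B(1) l by (intro sum_pos2[where i = b]) (auto simp: less_imp_le)
    also have "\<dots> = x \<bullet> (R *v x)"
      by (simp add: Rv inner_sum_right inner_commute power2_eq_square mult_ac)
    finally show "0 < x \<bullet> (R *v x)" .
  qed
  ultimately show ?thesis using that by blast
qed

text \<open>With \<open>D = R - T\<close>, equality of the squares reads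
  \<open>R ** D + D ** T = 0\<close>. Tested on an eigenvector of \<open>D\<close>, this is the
  eigenvalue times a positive number, so all eigenvalues of \<open>D\<close> vanish.\<close>

lemma pos_def_sqrt_unique:
  fixes R T :: "real ^ 'n ^ 'n"
  assumes R: "pos_def R" and T: "pos_def T" and eq: "R ** R = T ** T"
  shows "R = T"
proof -
  define D where "D = R - T"
  have sym: "transpose D = D" "transpose R = R" "transpose T = T"
    using R T by (auto simp: D_def pos_def_def transpose_def vec_eq_iff)
  have Dv: "D *v x = R *v x - T *v x" for x
    by (simp add: D_def matrix_vector_mult_diff_rdistrib)
  have zero: "l = 0" if l: "l \<in> eigenvalues D" for l
  proof -
    obtain v where v: "v \<noteq> 0" "D *v v = l *\<^sub>R v" using l unfolding eigenvalues_def by blast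
    have "R *v (R *v v) = T *v (T *v v)" by (simp add: matrix_vector_mul_assoc eq)
    then have "R *v (D *v v) + D *v (T *v v) = 0"
      by (simp add: Dv matrix_vector_mult_diff_distrib)
    then have "v \<bullet> (R *v (D *v v)) + v \<bullet> (D *v (T *v v)) = 0"
      by (metis inner_add_right inner_zero_right)
    moreover have "v \<bullet> (D *v (T *v v)) = l * (v \<bullet> (T *v v))"
      using symmetric_inner[OF sym(1), of v "T *v v"] v(2) by simp
    ultimately have "l * (v \<bullet> (R *v v) + v \<bullet> (T *v v)) = 0"
      using v(2) by (simp add: matrix_vector_mult_scaleR algebra_simps)
    moreover have "0 < v \<bullet> (R *v v) + v \<bullet> (T *v v)" using R T v(1) by (simp add: pos_def_def add_pos_pos)
    ultimately show ?thesis by simp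
  qed
  have q: "w \<bullet> (D *v w) = 0" for w
    using symmetric_Max_eigenvalue(2)[OF sym(1), of w] symmetric_Min_eigenvalue(2)[OF sym(1), of w]
      zero[OF symmetric_Max_eigenvalue(1)[OF sym(1)]] zero[OF symmetric_Min_eigenvalue(1)[OF sym(1)]]
    by simp
  have "D *v x = 0" for x
  proof -
    \<comment> \<open>Polarisation: the form of \<open>D\<close> is zero everywhere, and its value
      at \<open>x + ?y\<close> isolates \<open>?y \<bullet> ?y\<close>.\<close>
    let ?y = "D *v x"
    have "(x + ?y) \<bullet> (D *v (x + ?y)) = 0" by (rule q)
    then have "x \<bullet> (D *v ?y) + ?y \<bullet> ?y = 0"
      using q by (simp add: matrix_vector_right_distrib inner_add_left inner_add_right)
    then show ?thesis using symmetric_inner[OF sym(1), of x ?y] by simp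
  qed
  then have "R *v x = T *v x" for x using Dv[of x] by simp
  then show ?thesis by (simp add: matrix_eq)
qed

lemma pos_def_invertible:
  fixes A :: "real ^ 'n ^ 'n"
  assumes "pos_def A"
  shows "invertible A"
proof -
  have "x = 0" if "A *v x = 0" for x
    using assms that unfolding pos_def_def by (metis inner_zero_right less_irrefl)
  then show ?thesis by (simp add: invertible_left_inverse matrix_left_invertible_ker)
qed

lemma pos_def_matrix_inv:
  fixes A :: "real ^ 'n ^ 'n"
  assumes "pos_def A"
  shows "pos_def (matrix_inv A)"
proof -
  let ?B = "matrix_inv A"
  have inv: "A ** ?B = mat 1" "?B ** A = mat 1"
    using pos_def_invertible[OF assms] unfolding matrix_inv_def invertible_def
    by (auto intro: someI2_ex)
  have symA: "transpose A = A" using assms by (simp add: pos_def_def)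
  have AB: "A *v (?B *v x) = x" for x by (simp add: matrix_vector_mul_assoc inv)
  show ?thesis
    unfolding pos_def_def
  proof (intro conjI allI impI)
    have "transpose ?B ** A = mat 1" by (metis inv(1) matrix_transpose_mul symA transpose_mat)
    then show "transpose ?B = ?B" by (metis inv(1) matrix_mul_assoc matrix_mul_lid matrix_mul_rid)
    fix v :: "real ^ 'n" assume "v \<noteq> 0"
    then have "?B *v v \<noteq> 0" using AB[of v] by auto
    then have "0 < (?B *v v) \<bullet> (A *v (?B *v v))" using assms by (simp add: pos_def_def)
    then show "0 < v \<bullet> (?B *v v)" by (simp add: AB inner_commute)
  qed
qed

lemma pos_def_inv_sqrt:
  fixes A :: "real ^ 'n ^ 'n"
  assumes "pos_def A"
  shows "pos_def (inv_sqrt A)"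
proof -
  obtain R where R: "pos_def R" "R ** R = matrix_inv A"
    using pos_def_sqrt_exists[OF pos_def_matrix_inv[OF assms]] .
  then have "inv_sqrt A = R"
    unfolding inv_sqrt_def by (intro the_equality) (auto intro: pos_def_sqrt_unique)
  then show ?thesis using R by simp
qed

subsection \<open>Scatter matrices and distances to hyperplanes\<close>

lemma transpose_scatter: "transpose (scatter X H) = scatter X H"
  by (simp add: scatter_def Let_def ave_def transpose_def vec_eq_iff mult.commute)

lemma scatter_quadratic_form:
  fixes v :: "real ^ 'n"
  shows "v \<bullet> (scatter X H *v v) = ave (\<lambda>i. ((X ! i - ave ((!) X) H) \<bullet> v)\<^sup>2) H"
proof -
  define d where "d i = X ! i - ave ((!) X) H" for i
  have "v \<bullet> (scatter X H *v v)
      = (\<Sum>j\<in>UNIV. \<Sum>k\<in>UNIV. \<Sum>i\<in>H. v $ j * (d i $ j * d i $ k * v $ k)) / card H"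
    by (simp add: scatter_def Let_def ave_def inner_vec_def matrix_vector_mult_def d_def
        sum_distrib_left sum_distrib_right sum_divide_distrib divide_inverse mult_ac)
  also have "(\<Sum>j\<in>UNIV. \<Sum>k\<in>UNIV. \<Sum>i\<in>H. v $ j * (d i $ j * d i $ k * v $ k))
      = (\<Sum>j\<in>UNIV. \<Sum>i\<in>H. \<Sum>k\<in>UNIV. v $ j * (d i $ j * d i $ k * v $ k))"
    by (intro sum.cong refl sum.swap)
  also have "\<dots> = (\<Sum>i\<in>H. \<Sum>j\<in>UNIV. \<Sum>k\<in>UNIV. v $ j * (d i $ j * d i $ k * v $ k))"
    by (rule sum.swap)
  also have "\<dots> = (\<Sum>i\<in>H. (d i \<bullet> v)\<^sup>2)"
    by (simp add: inner_vec_def power2_eq_square sum_product mult_ac)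
  finally show ?thesis by (simp add: ave_def d_def divide_inverse mult.commute)
qed

lemma unit_normal_of_hyperplane:
  fixes T :: "(real ^ 'n) set"
  assumes "aff_dim T = int CARD('n) - 1"
  obtains a b where "norm a = 1" "affine hull T = {x. x \<bullet> a = b}"
    "\<And>y. sq_dist (affine hull T) y = (y \<bullet> a - b)\<^sup>2"
proof -
  obtain a b where ab: "a \<noteq> 0" "T \<subseteq> {x. a \<bullet> x = b}"
    using aff_lowdim_subset_hyperplane[of T] assms by auto
  define a' b' where "a' = a /\<^sub>R norm a" and "b' = b / norm a"
  have n: "norm a' = 1" using ab by (simp add: a'_def)
  then have "a' \<noteq> 0" by auto
  have "affine hull T = {x. x \<bullet> a' = b'}"
    using ab assms \<open>a' \<noteq> 0\<close>
    by (intro affine_hull_eq_hyperplane) (auto simp: a'_def b'_def inner_commute divide_inverse)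
  moreover from this have "sq_dist (affine hull T) y = (y \<bullet> a' - b')\<^sup>2" for y
    using sq_dist_hyperplane[OF \<open>a' \<noteq> 0\<close>, of b' y] n by (simp add: inner_commute)
  ultimately show ?thesis using that n by blast
qed

subsection \<open>Point sets in general position\<close>

text \<open>Points rather than positions, since a corrupted sample may list genuine rows in another
  order. Hyperplanes are given by equations, the form in which projections produce them.\<close>

definition gen_pos :: "(real ^ 'n) set \<Rightarrow> bool" where
  "gen_pos D \<longleftrightarrow> finite D \<and> CARD('n) < card D \<and>
     (\<forall>a b. a \<noteq> 0 \<longrightarrow> card (D \<inter> {x. x \<bullet> a = b}) \<le> CARD('n))"

lemma gen_pos_not_in_hyperplane:
  fixes D :: "(real ^ 'n) set"
  assumes "gen_pos D" "K \<subseteq> D" "CARD('n) < card K" "a \<noteq> 0"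
  obtains x where "x \<in> K" "x \<bullet> a \<noteq> b"
proof (rule ccontr)
  assume "\<not> thesis"
  then have "K \<subseteq> D \<inter> {x. x \<bullet> a = b}" using that assms(2) by auto
  then have "card K \<le> card (D \<inter> {x. x \<bullet> a = b})"
    using assms(1) by (intro card_mono) (auto simp: gen_pos_def)
  moreover have "card (D \<inter> {x. x \<bullet> a = b}) \<le> CARD('n)" using assms(1,4) by (simp add: gen_pos_def)
  ultimately show False using assms(3) by linarith
qed

lemma gen_pos_simplex:
  fixes D :: "(real ^ 'n) set"
  assumes "gen_pos D" "K \<subseteq> D" "card K = CARD('n) + 1"
  shows "\<not> affine_dependent K" "aff_dim K = int CARD('n)"
proof -
  have fin: "finite K" using assms by (meson finite_subset gen_pos_def)
  show dim: "aff_dim K = int CARD('n)"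
  proof (rule ccontr)
    assume "aff_dim K \<noteq> int CARD('n)"
    then have "aff_dim K < DIM(real ^ 'n)" using aff_dim_le_DIM[of K] by simp
    then obtain a b where "a \<noteq> 0" "K \<subseteq> {x. a \<bullet> x = b}" by (rule aff_lowdim_subset_hyperplane)
    then show False
      using gen_pos_not_in_hyperplane[OF assms(1,2), of a b] assms(3) by (auto simp: inner_commute)
  qed
  show "\<not> affine_dependent K"
    using fin dim assms(3) by (simp add: affine_independent_iff_card)
qed

lemma gen_pos_extend:
  fixes D :: "(real ^ 'n) set"
  assumes "gen_pos D" "J \<subseteq> D" "card J = CARD('n)"
  obtains x where "x \<in> D" "x \<notin> J"
proof -
  have "card J < card D" using assms by (simp add: gen_pos_def)
  then have "\<not> D \<subseteq> J"
    using assms by (metis card_mono finite_subset gen_pos_def not_le)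
  then show ?thesis using that by blast
qed

text \<open>Any further point of \<open>D\<close> completes \<open>J\<close> to an affinely
  independent simplex, which yields both claims.\<close>

lemma gen_pos_facet:
  fixes D :: "(real ^ 'n) set"
  assumes D: "gen_pos D" "J \<subseteq> D" "card J = CARD('n)"
  shows "aff_dim J = int CARD('n) - 1"
    and "\<And>x. x \<in> D \<Longrightarrow> x \<notin> J \<Longrightarrow> x \<notin> affine hull J"
proof -
  have fin: "finite J" using D by (meson finite_subset gen_pos_def)
  have ind: "\<not> affine_dependent (insert x J)" if "x \<in> D" "x \<notin> J" for x
    using gen_pos_simplex(1)[of D "insert x J"] D fin that by simp
  obtain x where "x \<in> D" "x \<notin> J" using gen_pos_extend[OF D] .
  then have "\<not> affine_dependent J" using ind affine_dependent_subset by blast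
  then show "aff_dim J = int CARD('n) - 1"
    using D(3) aff_dim_affine_independent by fastforce
  fix x assume "x \<in> D" "x \<notin> J"
  then show "x \<notin> affine hull J" using ind[of x] unfolding affine_dependent_def by auto
qed

section \<open>Distances from points to facets\<close>

lemma sq_dist_pos:
  assumes "closed P" "P \<noteq> {}" "x \<notin> P"
  shows "0 < sq_dist P x"
  using assms by (simp add: sq_dist_def in_closed_iff_infdist_zero)

lemma sq_dist_nonneg: "0 \<le> sq_dist P x"
  by (simp add: sq_dist_def)

text \<open>A finite \<open>D\<close> has finitely many facets and distances, and the distances of
  points off a facet are positive. The constants depend on \<open>D\<close> alone, so all corrupted
  samples share them.\<close>

lemma gen_pos_sq_dist_bounds:
  fixes D :: "(real ^ 'n) set"
  assumes "gen_pos D"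
  obtains \<delta> M where "0 < \<delta>" "\<delta> \<le> 1" "1 \<le> M"
    "\<And>J x. J \<subseteq> D \<Longrightarrow> card J = CARD('n) \<Longrightarrow> x \<in> D \<Longrightarrow> sq_dist (affine hull J) x \<le> M"
    "\<And>J x. J \<subseteq> D \<Longrightarrow> card J = CARD('n) \<Longrightarrow> x \<in> D - J \<Longrightarrow> \<delta> \<le> sq_dist (affine hull J) x"
proof -
  let ?f = "\<lambda>(J, x). sq_dist (affine hull J) x"
  \<comment> \<open>The extra value \<open>1\<close> keeps the positive values non-empty and forces
    \<open>\<delta> \<le> 1 \<le> M\<close>, so that logarithms of
    \<open>M * length Y / \<delta>\<close> are nonnegative later.\<close>
  define V where "V = insert 1 (?f ` (Pow D \<times> D))"
  have fin: "finite V" using assms by (simp add: V_def gen_pos_def)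
  define W where "W = {r \<in> V. 0 < r}"
  have W: "finite W" "1 \<in> W" using fin by (auto simp: W_def V_def)
  then have "Min W \<in> W" by (intro Min_in) auto
  show ?thesis
  proof (rule that[of "Min W" "Max V"])
    show "0 < Min W" using \<open>Min W \<in> W\<close> by (simp add: W_def)
    show "Min W \<le> 1" "1 \<le> Max V" using W fin by (auto simp: V_def)
    fix J x assume J: "J \<subseteq> D" "card J = CARD('n)"
    {
      assume "x \<in> D"
      then have "sq_dist (affine hull J) x \<in> V" using J by (force simp: V_def)
    } note V = this
    show "sq_dist (affine hull J) x \<le> Max V" if "x \<in> D" using V[OF that] fin by simp
    assume x: "x \<in> D - J"
    have "J \<noteq> {}" using J(2) by auto
    then have "0 < sq_dist (affine hull J) x"
      using x gen_pos_facet(2)[OF assms J] by (intro sq_dist_pos) auto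
    then have "sq_dist (affine hull J) x \<in> W" using V x by (simp add: W_def)
    then show "Min W \<le> sq_dist (affine hull J) x" using W by simp
  qed
qed

text \<open>The barycentric coordinate of a point at the vertex \<open>x\<close> is the ratio of the distances of
  that point and of \<open>x\<close> to the opposite facet.\<close>
lemma norm_le_facet_distances:
  fixes D :: "(real ^ 'n) set"
  assumes D: "gen_pos D" and K: "K \<subseteq> D" "card K = CARD('n) + 1"
  shows "norm y \<le> (\<Sum>x\<in>K. sqrt (sq_dist (affine hull (K - {x})) y / sq_dist (affine hull (K - {x})) x) * norm x)"
proof -
  have fin: "finite K" using K(2) by (metis add_is_0 card.infinite one_neq_zero)
  have "affine hull K = UNIV" using gen_pos_simplex(2)[OF D K] by (simp flip: aff_dim_eq_full)
  then have "y \<in> {y. \<exists>u. sum u K = 1 \<and> (\<Sum>v\<in>K. u v *\<^sub>R v) = y}"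
    using affine_hull_finite[OF fin] by (metis UNIV_I)
  then obtain u where u: "sum u K = 1" "(\<Sum>v\<in>K. u v *\<^sub>R v) = y" by blast
  have coord: "\<bar>u x\<bar> = sqrt (sq_dist (affine hull (K - {x})) y / sq_dist (affine hull (K - {x})) x)"
    if x: "x \<in> K" for x
  proof -
    have J: "K - {x} \<subseteq> D" "card (K - {x}) = CARD('n)" using K x fin by auto
    obtain a b where a: "norm a = 1" "affine hull (K - {x}) = {z. z \<bullet> a = b}"
      "\<And>z. sq_dist (affine hull (K - {x})) z = (z \<bullet> a - b)\<^sup>2"
      using unit_normal_of_hyperplane[OF gen_pos_facet(1)[OF D J]] by blast
    have "x \<notin> affine hull (K - {x})" using gen_pos_facet(2)[OF D J] x K by auto
    then have ne: "x \<bullet> a - b \<noteq> 0" using a(2) by simp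
    have on: "v \<bullet> a - b = 0" if "v \<in> K - {x}" for v
      using hull_inc[OF that, of affine] a(2) by simp
    have "y \<bullet> a - b = (\<Sum>v\<in>K. u v * (v \<bullet> a)) - (\<Sum>v\<in>K. u v) * b"
      using u by (simp flip: u(2) add: inner_sum_left)
    also have "\<dots> = (\<Sum>v\<in>K. u v * (v \<bullet> a - b))"
      by (simp add: right_diff_distrib sum_subtractf sum_distrib_right)
    also have "\<dots> = (\<Sum>v\<in>{x}. u v * (v \<bullet> a - b))"
      using fin x on by (intro sum.mono_neutral_right) auto
    finally have "u x = (y \<bullet> a - b) / (x \<bullet> a - b)" using ne by simp
    then show ?thesis by (simp add: a(3) flip: power_divide)
  qed
  have "norm y \<le> (\<Sum>v\<in>K. norm (u v *\<^sub>R v))" unfolding u(2)[symmetric] by (rule norm_sum)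
  then show ?thesis using coord by simp
qed

section \<open>Spread of genuine points in every direction\<close>

text \<open>The sum is homogeneous of degree two in the pair \<open>(v, s)\<close>, so its minimum
  on the unit sphere of the product space decides; a zero there would put \<open>K\<close> into a
  hyperplane. The centre \<open>s\<close> is free because contaminated rows can shift the subset
  mean.\<close>

lemma gen_pos_spread_pos:
  fixes D :: "(real ^ 'n) set"
  assumes "gen_pos D" "K \<subseteq> D" "CARD('n) < card K"
  obtains \<kappa> where "0 < \<kappa>" "\<And>v s. \<kappa> * (v \<bullet> v) \<le> (\<Sum>x\<in>K. (x \<bullet> v - s)\<^sup>2)"
proof -
  let ?g = "\<lambda>z. \<Sum>x\<in>K. (x \<bullet> fst z - snd z)\<^sup>2"
  let ?S = "sphere (0 :: (real ^ 'n) \<times> real) 1"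
  have fin: "finite K" using assms by (meson finite_subset gen_pos_def)
  have cont: "continuous_on ?S ?g" by (intro continuous_intros)
  have "(0, 1) \<in> ?S" by (simp add: norm_Pair)
  then have "?S \<noteq> {}" by blast
  from continuous_attains_inf[OF compact_sphere this cont]
  obtain z where z: "z \<in> ?S" and min: "\<forall>w\<in>?S. ?g z \<le> ?g w" by (rule bexE)
  have pos: "0 < ?g z"
  proof (rule ccontr)
    assume "\<not> 0 < ?g z"
    moreover have "0 \<le> ?g z" by (intro sum_nonneg) simp
    ultimately have "?g z = 0" by simp
    then have eq: "x \<bullet> fst z = snd z" if "x \<in> K" for x
      using that fin by (simp add: sum_nonneg_eq_0_iff)
    have "fst z = 0"
    proof (rule ccontr)
      assume "fst z \<noteq> 0"
      then show False using gen_pos_not_in_hyperplane[OF assms] eq by metis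
    qed
    moreover have "K \<noteq> {}" using assms(3) by auto
    ultimately have "z = 0" using eq by (auto simp: prod_eq_iff)
    then show False using z by simp
  qed
  have "?g z * (v \<bullet> v) \<le> (\<Sum>x\<in>K. (x \<bullet> v - s)\<^sup>2)" for v s
  proof (cases "v = 0")
    case False
    define r where "r = norm (v, s)"
    have r: "0 < r" using False by (simp add: r_def prod_eq_iff)
    have "norm ((v, s) /\<^sub>R r) = 1" using r unfolding norm_scaleR by (simp add: r_def)
    then have "(v, s) /\<^sub>R r \<in> ?S" by (simp del: scaleR_Pair)
    from min[rule_format, OF this] have "?g z \<le> (\<Sum>x\<in>K. (x \<bullet> v / r - s / r)\<^sup>2)"
      by (simp add: divide_inverse mult.commute)
    also have "\<dots> = (\<Sum>x\<in>K. (x \<bullet> v - s)\<^sup>2) / r\<^sup>2"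
      by (simp add: diff_divide_distrib[symmetric] power_divide sum_divide_distrib)
    finally have "?g z * r\<^sup>2 \<le> (\<Sum>x\<in>K. (x \<bullet> v - s)\<^sup>2)" using r by (simp add: pos_le_divide_eq)
    moreover have "v \<bullet> v \<le> r\<^sup>2" by (simp add: r_def norm_Pair dot_square_norm)
    then have "?g z * (v \<bullet> v) \<le> ?g z * r\<^sup>2" using pos by (intro mult_left_mono) auto
    ultimately show ?thesis by linarith
  qed (simp add: sum_nonneg)
  then show ?thesis using that[of "?g z"] pos by blast
qed

lemma gen_pos_spread_pos_uniform:
  fixes D :: "(real ^ 'n) set"
  assumes "gen_pos D"
  obtains \<kappa> where "0 < \<kappa>"
    "\<And>K v s. K \<subseteq> D \<Longrightarrow> CARD('n) < card K \<Longrightarrow> \<kappa> * (v \<bullet> v) \<le> (\<Sum>x\<in>K. (x \<bullet> v - s)\<^sup>2)"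
proof -
  let ?F = "{K. K \<subseteq> D \<and> CARD('n) < card K}"
  have "\<forall>K\<in>?F. \<exists>\<kappa>>0. \<forall>v s. \<kappa> * (v \<bullet> v) \<le> (\<Sum>x\<in>K. (x \<bullet> v - s)\<^sup>2)"
  proof
    fix K assume "K \<in> ?F"
    then obtain \<kappa> where "0 < \<kappa>" "\<And>v s. \<kappa> * (v \<bullet> v) \<le> (\<Sum>x\<in>K. (x \<bullet> v - s)\<^sup>2)"
      using gen_pos_spread_pos[OF assms] by blast
    then show "\<exists>\<kappa>>0. \<forall>v s. \<kappa> * (v \<bullet> v) \<le> (\<Sum>x\<in>K. (x \<bullet> v - s)\<^sup>2)" by blast
  qed
  from bchoice[OF this] obtain k where
    k: "\<forall>K\<in>?F. 0 < k K \<and> (\<forall>v s. k K * (v \<bullet> v) \<le> (\<Sum>x\<in>K. (x \<bullet> v - s)\<^sup>2))" by (rule exE)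
  have F: "finite ?F" "D \<in> ?F" using assms by (auto simp: gen_pos_def)
  have img: "finite (k ` ?F)" "k ` ?F \<noteq> {}" using F by blast+
  show ?thesis
  proof (rule that[of "Min (k ` ?F)"])
    show "0 < Min (k ` ?F)" using Min_in[OF img] k by auto
    fix K and v :: "real ^ 'n" and s assume "K \<subseteq> D" "CARD('n) < card K"
    then have K: "K \<in> ?F" by simp
    have "Min (k ` ?F) * (v \<bullet> v) \<le> k K * (v \<bullet> v)"
      using K img by (intro mult_right_mono Min_le) auto
    then show "Min (k ` ?F) * (v \<bullet> v) \<le> (\<Sum>x\<in>K. (x \<bullet> v - s)\<^sup>2)" using k K by (meson order_trans)
  qed
qed

subsection \<open>The incongruence index of contaminated samples\<close>

lemma card_nth_sort:
  "card {i. i < length ds \<and> Q (sort ds ! i)} = card {i. i < length ds \<and> Q (ds ! i)}"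
proof -
  have "length (filter Q (sort ds)) = length (filter Q ds)"
    by (metis mset_filter mset_sort size_mset)
  then show ?thesis unfolding length_filter_conv_card by simp
qed

lemma card_le_order_stat:
  assumes "0 < h" "h \<le> length ds"
  shows "h \<le> card {i. i < length ds \<and> ds ! i \<le> order_stat h ds}"
proof -
  have "{..<h} \<subseteq> {i. i < length ds \<and> sort ds ! i \<le> order_stat h ds}"
    using assms by (auto simp: order_stat_def intro!: sorted_nth_mono)
  then have "card {..<h} \<le> card {i. i < length ds \<and> sort ds ! i \<le> order_stat h ds}"
    by (intro card_mono) auto
  then show ?thesis using card_nth_sort[of ds "\<lambda>x. x \<le> order_stat h ds"] by simp
qed

lemma order_stat_le:
  assumes "0 < h" "h \<le> card {i. i < length ds \<and> ds ! i \<le> B}"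
  shows "order_stat h ds \<le> B"
proof (rule ccontr)
  assume less: "\<not> order_stat h ds \<le> B"
  \<comment> \<open>From index \<open>h - 1\<close> on, the sorted list stays at or above the order
    statistic, so fewer than \<open>h\<close> entries could be at most \<open>B\<close>.\<close>
  have "i < h - 1" if i: "i < length ds" "sort ds ! i \<le> B" for i
  proof (rule ccontr)
    assume "\<not> i < h - 1"
    then have "sort ds ! (h - 1) \<le> sort ds ! i" using i by (intro sorted_nth_mono) auto
    then show False using i less by (simp add: order_stat_def)
  qed
  then have "{i. i < length ds \<and> sort ds ! i \<le> B} \<subseteq> {..<h - 1}" by auto
  then have "card {i. i < length ds \<and> sort ds ! i \<le> B} \<le> card {..<h - 1}"
    by (intro card_mono) auto
  then show False using assms card_nth_sort[of ds "\<lambda>x. x \<le> B"] by simp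
qed

lemma closest_subset: "closest h X P \<subseteq> {..<length X}"
  by (auto simp: closest_def)

lemma card_closest:
  assumes "0 < h" "h \<le> length X"
  shows "h \<le> card (closest h X P)"
proof -
  have "closest h X P = {i. i < length (map (sq_dist P) X)
      \<and> map (sq_dist P) X ! i \<le> order_stat h (map (sq_dist P) X)}"
    by (auto simp: closest_def)
  then show ?thesis using card_le_order_stat[of h "map (sq_dist P) X"] assms by simp
qed

text \<open>Any \<open>h\<close> positions within \<open>B\<close> certify that the
  \<open>h\<close>-th smallest distance is at most \<open>B\<close>. This controls
  \<open>closest\<close> without knowing its members.\<close>

lemma closest_le:
  assumes "i \<in> closest h X P" "0 < h" and H: "H \<subseteq> {..<length X}" "h \<le> card H"
    and B: "\<And>j. j \<in> H \<Longrightarrow> sq_dist P (X ! j) \<le> B"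
  shows "sq_dist P (X ! i) \<le> B"
proof -
  let ?S = "{i. i < length (map (sq_dist P) X) \<and> map (sq_dist P) X ! i \<le> B}"
  have "H \<subseteq> ?S" using H B by auto
  then have "card H \<le> card ?S" by (intro card_mono) auto
  then have "order_stat h (map (sq_dist P) X) \<le> B" using assms by (intro order_stat_le) auto
  then show ?thesis using assms(1) by (simp add: closest_def)
qed

section \<open>Averages and bounds for scatter matrices\<close>

lemma ave_real_eq: "ave f A = sum f A / real (card A)" for f :: "_ \<Rightarrow> real"
  by (simp add: ave_def divide_inverse mult.commute)

lemma ave_le:
  fixes f :: "_ \<Rightarrow> real"
  assumes "finite A" "A \<noteq> {}" "\<And>i. i \<in> A \<Longrightarrow> f i \<le> B"
  shows "ave f A \<le> B"
proof -
  have "0 < card A" using assms by (simp add: card_gt_0_iff)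
  then show ?thesis
    using sum_bounded_above[of A f B] assms(3) by (simp add: ave_real_eq pos_divide_le_eq mult.commute)
qed

lemma scatter_psd: "0 \<le> v \<bullet> (scatter X H *v v)"
  by (simp add: scatter_quadratic_form ave_real_eq sum_nonneg)

text \<open>The mean obeys the same bound as the projections, whence the factor 2. Only the
  direction \<open>v\<close> is constrained, so rows remote in an orthogonal direction are
  allowed.\<close>

lemma scatter_le:
  fixes v :: "real ^ 'n"
  assumes "finite H" "H \<noteq> {}" "\<And>i. i \<in> H \<Longrightarrow> \<bar>X ! i \<bullet> v\<bar> \<le> B"
  shows "v \<bullet> (scatter X H *v v) \<le> (2 * B)\<^sup>2"
  unfolding scatter_quadratic_form
proof (rule ave_le[OF assms(1,2)])
  fix i assume i: "i \<in> H"
  have c: "0 < card H" using assms by (simp add: card_gt_0_iff)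
  have "ave ((!) X) H \<bullet> v = ave (\<lambda>j. X ! j \<bullet> v) H" by (simp add: ave_def inner_sum_left)
  moreover have "\<bar>ave (\<lambda>j. X ! j \<bullet> v) H\<bar> \<le> ave (\<lambda>j. \<bar>X ! j \<bullet> v\<bar>) H"
    by (auto simp: ave_real_eq intro: divide_right_mono)
  moreover have "\<dots> \<le> B" using assms by (rule ave_le)
  ultimately have "\<bar>(X ! i - ave ((!) X) H) \<bullet> v\<bar> \<le> \<bar>2 * B\<bar>"
    using assms(3)[OF i] by (simp add: inner_diff_left)
  then show "((X ! i - ave ((!) X) H) \<bullet> v)\<^sup>2 \<le> (2 * B)\<^sup>2" by (rule abs_le_square_iff[THEN iffD1])
qed

lemma scatter_ge:
  fixes v :: "real ^ 'n"
  assumes "finite H" "G \<subseteq> H" "inj_on ((!) X) G"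
    and "\<And>s. \<kappa> * (v \<bullet> v) \<le> (\<Sum>x\<in>(!) X ` G. (x \<bullet> v - s)\<^sup>2)"
  shows "\<kappa> / card H * (v \<bullet> v) \<le> v \<bullet> (scatter X H *v v)"
proof -
  define s where "s = ave ((!) X) H \<bullet> v"
  have "\<kappa> * (v \<bullet> v) \<le> (\<Sum>i\<in>G. (X ! i \<bullet> v - s)\<^sup>2)"
    using assms(4)[of s] by (simp add: sum.reindex[OF assms(3)])
  also have "\<dots> \<le> (\<Sum>i\<in>H. (X ! i \<bullet> v - s)\<^sup>2)" using assms by (intro sum_mono2) auto
  finally show ?thesis
    by (simp add: scatter_quadratic_form ave_real_eq inner_diff_left s_def divide_right_mono)
qed

lemma finite_hyperplanes: "finite H \<Longrightarrow> finite (hyperplanes X H)"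
  and card_hyperplanes_le: "finite H \<Longrightarrow> card (hyperplanes X H) \<le> 2 ^ card H"
proof -
  assume fin: "finite H"
  have sub: "hyperplanes X H \<subseteq> (\<lambda>J. affine hull ((!) X ` J)) ` Pow H"
    unfolding hyperplanes_def by auto
  then show "finite (hyperplanes X H)" using fin by (auto intro: finite_subset)
  have "card (hyperplanes X H) \<le> card ((\<lambda>J. affine hull ((!) X ` J)) ` Pow H)"
    using fin sub by (intro card_mono) auto
  also have "\<dots> \<le> card (Pow H)" using fin by (intro card_image_le) auto
  finally show "card (hyperplanes X H) \<le> 2 ^ card H" using fin by (simp add: card_Pow)
qed

section \<open>Samples with enough genuine rows\<close>

text \<open>The first \<open>g\<close> rows of \<open>Y\<close> are genuine. \<open>D\<close> is
  kept apart from \<open>Y\<close> so that constants belonging to \<open>D\<close> can be fixed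
  before \<open>Y\<close>.\<close>

locale contaminated_sample =
  fixes D :: "(real ^ 'n) set" and Y :: "(real ^ 'n) list" and g h :: nat
  assumes gen_pos: "gen_pos D" and g_le: "g \<le> length Y" and h_le: "h \<le> g"
    and majority: "length Y + CARD('n) < 2 * h"
    and genuine: "(!) Y ` {..<g} \<subseteq> D" and inj: "inj_on ((!) Y) {..<g}"
begin

lemma h_pos: "0 < h"
  using majority by simp

lemma card_genuine:
  assumes "H \<subseteq> {..<length Y}" "h \<le> card H"
  shows "CARD('n) < card (H \<inter> {..<g})"
proof -
  have fin: "finite H" using assms finite_subset by blast
  have "card H \<le> card ((H \<inter> {..<g}) \<union> {g..<length Y})"
    using assms fin by (intro card_mono) auto
  also have "\<dots> \<le> card (H \<inter> {..<g}) + (length Y - g)"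
    using card_Un_le[of "H \<inter> {..<g}" "{g..<length Y}"] by simp
  finally show ?thesis using assms majority h_le g_le by linarith
qed

lemma genuine_image:
  assumes "J \<subseteq> {..<g}"
  shows "(!) Y ` J \<subseteq> D" "card ((!) Y ` J) = card J"
  using assms genuine card_image[OF inj_on_subset[OF inj assms]] by auto

text \<open>\<open>P\<close> may be spanned by contaminated rows, and \<open>H'\<close> need not be
  related to \<open>H\<close>. Taking for \<open>H'\<close> an \<open>h\<close>-subset,
  \<open>closest\<close> or \<open>on_hyperplane\<close> keeps both averages of the index positive
  and excludes an exact fit.\<close>

lemma hyperplane_misses_genuine:
  assumes P: "P \<in> hyperplanes Y H" and H': "H' \<subseteq> {..<length Y}" "h \<le> card H'"
  obtains i where "i \<in> H'" "i < g" "Y ! i \<notin> P" "0 < sq_dist P (Y ! i)"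
proof -
  obtain J where J: "P = affine hull ((!) Y ` J)" "aff_dim ((!) Y ` J) = int CARD('n) - 1"
    using P unfolding hyperplanes_def by auto
  obtain a b where a: "norm a = 1" "P = {x. x \<bullet> a = b}" "\<And>y. sq_dist P y = (y \<bullet> a - b)\<^sup>2"
    unfolding J(1) using unit_normal_of_hyperplane[OF J(2)] by blast
  let ?G = "H' \<inter> {..<g}"
  have "CARD('n) < card ((!) Y ` ?G)" using card_genuine[OF H'] genuine_image(2)[of ?G] by simp
  moreover have "a \<noteq> 0" using a(1) by auto
  ultimately obtain x where "x \<in> (!) Y ` ?G" "x \<bullet> a \<noteq> b"
    using gen_pos_not_in_hyperplane[OF gen_pos genuine_image(1)[of ?G]] by (metis Int_lower2)
  then show ?thesis using that a by auto
qed

definition mean_dist :: "(real ^ 'n) set \<Rightarrow> nat set \<Rightarrow> real" where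
  "mean_dist P H = ave (\<lambda>i. sq_dist P (Y ! i)) H"

definition log_incongruence :: "nat set \<Rightarrow> (real ^ 'n) set \<Rightarrow> real" where
  "log_incongruence H P = ln (mean_dist P H / mean_dist P (closest h Y P))"

lemma h_le_length: "h \<le> length Y"
  using h_le g_le by simp

lemma h_subsetsD:
  assumes "H \<in> h_subsets (length Y) h"
  shows "H \<subseteq> {..<length Y}" "card H = h" "finite H" "H \<noteq> {}"
  using assms h_pos finite_subset[of H "{..<length Y}"] by (auto simp: h_subsets_def)

lemma finite_closest: "finite (closest h Y P)"
  using finite_subset[OF closest_subset] by simp

lemma closest_nonempty: "closest h Y P \<noteq> {}"
  using card_closest[OF h_pos h_le_length, of P] h_pos by auto

lemma mean_dist_pos:
  assumes P: "P \<in> hyperplanes Y H" and H': "H' \<subseteq> {..<length Y}" "h \<le> card H'"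
  shows "0 < mean_dist P H'"
proof -
  have fin: "finite H'" using H' finite_subset by blast
  obtain i where "i \<in> H'" "0 < sq_dist P (Y ! i)" using hyperplane_misses_genuine[OF P H'] .
  then have "0 < (\<Sum>i\<in>H'. sq_dist P (Y ! i))" using fin sq_dist_nonneg by (intro sum_pos2[of _ i]) auto
  moreover have "0 < card H'" using H' h_pos by linarith
  ultimately show ?thesis by (simp add: mean_dist_def ave_real_eq)
qed

lemma mean_dist_closest_pos:
  assumes "P \<in> hyperplanes Y H"
  shows "0 < mean_dist P (closest h Y P)"
  by (rule mean_dist_pos[OF assms closest_subset card_closest[OF h_pos h_le_length]])

text \<open>Both averages are positive, so none of the special values of \<open>log_ratio\<close>
  occurs and the index is an ordinary real average.\<close>

lemma incongruence_eq:
  assumes H: "H \<in> h_subsets (length Y) h"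
  shows "incongruence h Y H =
    ereal ((\<Sum>P\<in>hyperplanes Y H. log_incongruence H P) / card (hyperplanes Y H))"
proof -
  have "incongruence_along h Y H P = ereal (log_incongruence H P)" if P: "P \<in> hyperplanes Y H" for P
    using mean_dist_pos[OF P, of H] mean_dist_closest_pos[OF P] h_subsetsD[OF H]
    by (simp add: incongruence_along_def log_ratio_def log_incongruence_def mean_dist_def)
  then have "(\<Sum>P\<in>hyperplanes Y H. incongruence_along h Y H P)
      = ereal (\<Sum>P\<in>hyperplanes Y H. log_incongruence H P)"
    by (simp add: sum_ereal)
  \<comment> \<open>Without hyperplanes both sides are \<open>0 / 0 = 0\<close>.\<close>
  moreover have "hyperplanes Y H = {}" if "card (hyperplanes Y H) = 0"
    using that finite_hyperplanes[OF h_subsetsD(3)[OF H], of Y] by simp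
  ultimately show ?thesis
    by (cases "card (hyperplanes Y H) = 0") (simp_all add: incongruence_def)
qed

text \<open>The index may be negative, since ties enlarge \<open>closest\<close> beyond \<open>h\<close> positions.\<close>
lemma log_incongruence_ge:
  assumes H: "H \<in> h_subsets (length Y) h" and P: "P \<in> hyperplanes Y H"
  shows "- ln h \<le> log_incongruence H P"
proof -
  note Hs = h_subsetsD[OF H]
  \<comment> \<open>The sum over \<open>H\<close> dominates each distance in \<open>H\<close>, hence
    each one in \<open>closest\<close>. It equals \<open>h\<close> times the mean, the origin of
    \<open>- ln h\<close>.\<close>
  have "mean_dist P (closest h Y P) \<le> (\<Sum>i\<in>H. sq_dist P (Y ! i))"
    unfolding mean_dist_def
  proof (rule ave_le[OF finite_closest closest_nonempty])
    fix i assume "i \<in> closest h Y P"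
    then show "sq_dist P (Y ! i) \<le> (\<Sum>i\<in>H. sq_dist P (Y ! i))"
    proof (rule closest_le[OF _ h_pos Hs(1)])
      fix j assume "j \<in> H"
      then show "sq_dist P (Y ! j) \<le> (\<Sum>i\<in>H. sq_dist P (Y ! i))"
        using Hs(3) by (intro member_le_sum sq_dist_nonneg)
    qed (simp add: Hs(2))
  qed
  also have "\<dots> = h * mean_dist P H" using Hs h_pos by (simp add: mean_dist_def ave_real_eq)
  finally have "1 / h \<le> mean_dist P H / mean_dist P (closest h Y P)"
    using mean_dist_closest_pos[OF P] h_pos by (simp add: field_simps)
  then have "ln (1 / h) \<le> log_incongruence H P"
    unfolding log_incongruence_def using h_pos by (intro ln_mono) auto
  then show ?thesis using h_pos by (simp add: ln_div)
qed

lemma pcs_subset_is_arg_min: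
  assumes "pcs_subset h Y H"
  shows "is_arg_min (incongruence h Y) (\<lambda>H. H \<in> h_subsets (length Y) h) H"
proof -
  have "card (on_hyperplane Y P) < h" if P: "P \<in> hyperplanes Y H\<^sub>0" for P H\<^sub>0
  proof (rule ccontr)
    assume "\<not> card (on_hyperplane Y P) < h"
    then obtain i where "i \<in> on_hyperplane Y P" "0 < sq_dist P (Y ! i)"
      using hyperplane_misses_genuine[OF P, of "on_hyperplane Y P"] by (auto simp: on_hyperplane_def)
    then show False by (simp add: on_hyperplane_def)
  qed
  then have "{P \<in> hyperplanes Y H\<^sub>0. h \<le> card (on_hyperplane Y P)} = {}" for H\<^sub>0
    by (auto simp: not_le)
  then show ?thesis using assms by (auto simp: pcs_subset_def)
qed

end

section \<open>Uniform bounds on the minimiser\<close>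

locale contaminated_sample_bounds = contaminated_sample D Y g h
  for D :: "(real ^ 'n) set" and Y :: "(real ^ 'n) list" and g h :: nat +
  fixes \<delta> M :: real
  assumes \<delta>: "0 < \<delta>" "\<delta> \<le> 1" and M: "1 \<le> M"
    and sq_dist_le: "\<And>J x. J \<subseteq> D \<Longrightarrow> card J = CARD('n) \<Longrightarrow> x \<in> D \<Longrightarrow> sq_dist (affine hull J) x \<le> M"
    and sq_dist_ge: "\<And>J x. J \<subseteq> D \<Longrightarrow> card J = CARD('n) \<Longrightarrow> x \<in> D - J \<Longrightarrow> \<delta> \<le> sq_dist (affine hull J) x"
begin

lemma genuine_initial: "{..<h} \<in> h_subsets (length Y) h"
  using h_le_length by (auto simp: h_subsets_def)

text \<open>The numerator averages genuine distances. In the denominator, \<open>closest\<close> has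
  a genuine row off \<open>P\<close>, contributing at least \<open>\<delta>\<close>; as ties may
  enlarge \<open>closest\<close>, it is shared among up to \<open>length Y\<close>
  positions.\<close>

lemma log_incongruence_initial_le:
  assumes P: "P \<in> hyperplanes Y {..<h}"
  shows "log_incongruence {..<h} P \<le> ln (M * length Y / \<delta>)"
proof -
  obtain J where J: "J \<subseteq> {..<h}" "card J = CARD('n)" "P = affine hull ((!) Y ` J)"
    using P unfolding hyperplanes_def by blast
  have "J \<subseteq> {..<g}" using J(1) h_le by auto
  note img = genuine_image[OF this]
  have "mean_dist P {..<h} \<le> M"
    unfolding mean_dist_def
  proof (rule ave_le)
    fix i assume "i \<in> {..<h}"
    then have "Y ! i \<in> D" using genuine h_le by auto
    then show "sq_dist P (Y ! i) \<le> M" using J img by (simp add: sq_dist_le)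
  qed (use h_pos in auto)
  moreover have "\<delta> / length Y \<le> mean_dist P (closest h Y P)"
  proof -
    let ?C = "closest h Y P"
    obtain i where i: "i \<in> ?C" "i < g" "Y ! i \<notin> P"
      using hyperplane_misses_genuine[OF P closest_subset card_closest[OF h_pos h_le_length]] .
    then have "Y ! i \<notin> (!) Y ` J" using hull_inc[of "Y ! i" "(!) Y ` J" affine] J(3) by metis
    then have "\<delta> \<le> sq_dist P (Y ! i)" using i genuine img J by (simp add: sq_dist_ge image_subset_iff)
    also have "\<dots> \<le> (\<Sum>i\<in>?C. sq_dist P (Y ! i))"
      using i finite_closest by (intro member_le_sum sq_dist_nonneg)
    finally have "\<delta> \<le> (\<Sum>i\<in>?C. sq_dist P (Y ! i))" .
    moreover have "0 < card ?C" using closest_nonempty finite_closest by (simp add: card_gt_0_iff)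
    moreover have "card ?C \<le> length Y" using card_mono[OF _ closest_subset[of h Y P]] by simp
    ultimately show ?thesis using \<delta> unfolding mean_dist_def ave_real_eq by (intro frac_le) auto
  qed
  ultimately have "mean_dist P {..<h} / mean_dist P (closest h Y P) \<le> M / (\<delta> / length Y)"
  proof (intro frac_le)
    have "0 < length Y" using h_pos h_le_length by linarith
    then show "0 < \<delta> / length Y" using \<delta> by simp
  qed (use M in auto)
  moreover have "0 < mean_dist P {..<h} / mean_dist P (closest h Y P)"
    using mean_dist_closest_pos[OF P] mean_dist_pos[OF P, of "{..<h}"] h_le_length by simp
  ultimately show ?thesis unfolding log_incongruence_def by (simp add: ln_mono)
qed

lemma incongruence_initial_le: "incongruence h Y {..<h} \<le> ereal (ln (M * length Y / \<delta>))"
proof -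
  let ?L = "ln (M * length Y / \<delta>)" and ?N = "card (hyperplanes Y {..<h})"
  have "1 * 1 \<le> M * length Y" using M h_pos h_le_length by (intro mult_mono) auto
  then have L: "0 \<le> ?L" using \<delta> by simp
  have "(\<Sum>P\<in>hyperplanes Y {..<h}. log_incongruence {..<h} P) \<le> ?N * ?L"
    using log_incongruence_initial_le sum_bounded_above by blast
  then have "(\<Sum>P\<in>hyperplanes Y {..<h}. log_incongruence {..<h} P) / ?N \<le> ?L"
    using L by (cases "?N = 0") (auto simp: field_simps)
  then show ?thesis by (simp add: incongruence_eq[OF genuine_initial])
qed

text \<open>Solves \<open>d / h / M \<le> exp (2 ^ h * (L + ln h))\<close> for a squared distance
  \<open>d\<close>, with \<open>L\<close> the bound on the index of the genuine subset.\<close>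

definition dist_bound :: real where
  "dist_bound = h * M * exp (2 ^ h * (ln (M * length Y / \<delta>) + ln h))"

text \<open>A row at squared distance \<open>d\<close> lifts the numerator to at least
  \<open>d / h\<close> while the denominator stays below \<open>M\<close>, so minimality of the
  index limits \<open>d\<close>.\<close>

lemma genuine_facet_dist_le:
  assumes H: "H \<in> h_subsets (length Y) h" and inc: "incongruence h Y H \<le> incongruence h Y {..<h}"
    and J: "J \<subseteq> H" "J \<subseteq> {..<g}" "card J = CARD('n)" and i: "i \<in> H"
  shows "sq_dist (affine hull ((!) Y ` J)) (Y ! i) \<le> dist_bound"
proof (cases "sq_dist (affine hull ((!) Y ` J)) (Y ! i) = 0")
  case True
  then show ?thesis using M h_pos by (simp add: dist_bound_def)
next
  case False
  define P where "P = affine hull ((!) Y ` J)"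
  define d where "d = sq_dist P (Y ! i)"
  note Hs = h_subsetsD[OF H] and img = genuine_image[OF J(2)]
  let ?\<P> = "hyperplanes Y H" and ?L = "ln (M * length Y / \<delta>)"
  have "aff_dim ((!) Y ` J) = int CARD('n) - 1"
    using gen_pos_facet(1)[OF gen_pos img(1)] img(2) J(3) by simp
  then have P: "P \<in> ?\<P>" unfolding hyperplanes_def P_def using J by blast
  have d: "0 < d" using False sq_dist_nonneg[of P "Y ! i"] by (simp add: d_def P_def)
  \<comment> \<open>The genuine rows \<open>{..<h}\<close> certify this bound for
    \<open>closest\<close>.\<close>
  have "mean_dist P (closest h Y P) \<le> M"
    unfolding mean_dist_def
  proof (rule ave_le[OF finite_closest closest_nonempty])
    fix k assume "k \<in> closest h Y P"
    then show "sq_dist P (Y ! k) \<le> M"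
    proof (rule closest_le[OF _ h_pos])
      fix j assume "j \<in> {..<h}"
      then have "Y ! j \<in> D" using genuine h_le by auto
      then show "sq_dist P (Y ! j) \<le> M" unfolding P_def using img J by (intro sq_dist_le) auto
    qed (use h_le_length in auto)
  qed
  moreover have "d / h \<le> mean_dist P H"
    unfolding mean_dist_def ave_real_eq d_def Hs(2)
    using i Hs by (intro divide_right_mono member_le_sum sq_dist_nonneg) auto
  ultimately have "(d / h) / M \<le> mean_dist P H / mean_dist P (closest h Y P)"
    using mean_dist_closest_pos[OF P] mean_dist_pos[OF P Hs(1)] Hs(2) by (intro frac_le) auto
  moreover have "0 < (d / h) / M" using d h_pos M by simp
  ultimately have "ln ((d / h) / M) \<le> log_incongruence H P"
    unfolding log_incongruence_def by (intro ln_mono) auto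
  also have "\<dots> \<le> log_incongruence H P + ln h" using h_pos by simp
  \<comment> \<open>The shift by \<open>ln h\<close> makes every term nonnegative, so the term of
    \<open>P\<close> is at most the whole sum.\<close>
  also have "\<dots> \<le> (\<Sum>Q\<in>?\<P>. log_incongruence H Q + ln h)"
  proof (rule member_le_sum[where f = "\<lambda>Q. log_incongruence H Q + ln h", OF P])
    fix Q assume "Q \<in> ?\<P> - {P}"
    then show "0 \<le> log_incongruence H Q + ln h" using log_incongruence_ge[OF H, of Q] by simp
  qed (rule finite_hyperplanes[OF Hs(3)])
  also have "\<dots> = (\<Sum>Q\<in>?\<P>. log_incongruence H Q) + card ?\<P> * ln h"
    by (simp add: sum.distrib)
  also have "\<dots> \<le> card ?\<P> * (?L + ln h)"
  proof -
    have "(\<Sum>Q\<in>?\<P>. log_incongruence H Q) / card ?\<P> \<le> ?L"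
      using order_trans[OF inc incongruence_initial_le] by (simp add: incongruence_eq[OF H])
    moreover have "0 < card ?\<P>" using P finite_hyperplanes[OF Hs(3)] by (auto simp: card_gt_0_iff)
    ultimately show ?thesis by (simp add: pos_divide_le_eq algebra_simps)
  qed
  also have "\<dots> \<le> 2 ^ h * (?L + ln h)"
  proof (rule mult_right_mono)
    have "real (card ?\<P>) \<le> real (2 ^ h)"
      using card_hyperplanes_le[OF Hs(3), of Y] Hs(2) by (simp only: of_nat_le_iff)
    then show "real (card ?\<P>) \<le> 2 ^ h" by simp
    have "1 * 1 \<le> M * length Y" using M h_pos h_le_length by (intro mult_mono) auto
    then show "0 \<le> ?L + ln h" using \<delta> h_pos by (intro add_nonneg_nonneg) auto
  qed
  finally have "(d / h) / M \<le> exp (2 ^ h * (?L + ln h))"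
    using \<open>0 < (d / h) / M\<close> by (metis exp_le_cancel_iff exp_ln)
  then have "d \<le> dist_bound"
    using h_pos M by (simp add: dist_bound_def pos_divide_le_eq mult_ac)
  then show ?thesis by (simp add: d_def P_def)
qed

lemma arg_min_norm_le:
  assumes H: "is_arg_min (incongruence h Y) (\<lambda>H. H \<in> h_subsets (length Y) h) H"
    and i: "i \<in> H" and B: "\<And>x. x \<in> D \<Longrightarrow> norm x \<le> B"
  shows "norm (Y ! i) \<le> (CARD('n) + 1) * (sqrt (dist_bound / \<delta>) * B)"
proof -
  have Hh: "H \<in> h_subsets (length Y) h" and inc: "incongruence h Y H \<le> incongruence h Y {..<h}"
    using H genuine_initial by (auto simp: is_arg_min_linorder)
  let ?G = "H \<inter> {..<g}"
  \<comment> \<open>A simplex of genuine members of \<open>H\<close>: each of its facets is among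
    the hyperplanes averaged in the index of \<open>H\<close>.\<close>
  have "CARD('n) + 1 \<le> card ?G"
    using card_genuine[of H] h_subsetsD[OF Hh] by simp
  then obtain T where T: "T \<subseteq> ?G" "card T = CARD('n) + 1" "finite T"
    by (rule obtain_subset_with_card_n)
  define K where "K = (!) Y ` T"
  have K: "K \<subseteq> D" "card K = CARD('n) + 1"
    unfolding K_def using genuine_image[of T] T by auto
  have "norm (Y ! i) \<le> (\<Sum>x\<in>K. sqrt (sq_dist (affine hull (K - {x})) (Y ! i)
      / sq_dist (affine hull (K - {x})) x) * norm x)"
    by (rule norm_le_facet_distances[OF gen_pos K])
  also have "\<dots> \<le> (\<Sum>x\<in>K. sqrt (dist_bound / \<delta>) * B)"
  proof (rule sum_mono)
    fix x assume x: "x \<in> K"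
    then obtain t where t: "t \<in> T" "x = Y ! t" by (auto simp: K_def)
    have "inj_on ((!) Y) T" by (rule inj_on_subset[OF inj]) (use T in auto)
    then have Kx: "K - {x} = (!) Y ` (T - {t})"
      using t unfolding K_def by (auto simp: inj_on_def)
    have c: "card (T - {t}) = CARD('n)" using T t by simp
    have "sq_dist (affine hull (K - {x})) (Y ! i) \<le> dist_bound"
      unfolding Kx using T c i by (intro genuine_facet_dist_le[OF Hh inc]) auto
    moreover have "\<delta> \<le> sq_dist (affine hull (K - {x})) x"
      using x K by (intro sq_dist_ge) auto
    ultimately have "sq_dist (affine hull (K - {x})) (Y ! i) / sq_dist (affine hull (K - {x})) x \<le> dist_bound / \<delta>"
      using \<delta> sq_dist_nonneg by (intro frac_le) (auto intro: order_trans)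
    moreover have "0 \<le> dist_bound" using M by (simp add: dist_bound_def)
    ultimately show "sqrt (sq_dist (affine hull (K - {x})) (Y ! i) / sq_dist (affine hull (K - {x})) x) * norm x
        \<le> sqrt (dist_bound / \<delta>) * B"
      using B x K \<delta> by (intro mult_mono real_sqrt_le_mono) auto
  qed
  finally show ?thesis using K(2) by simp
qed

end

subsection \<open>The breakdown point\<close>

lemma gen_pos_set:
  fixes X :: "(real ^ 'n) list"
  assumes X: "general_position X" and d: "distinct X" and l: "CARD('n) < length X"
  shows "gen_pos (set X)"
  unfolding gen_pos_def
proof (intro conjI allI impI)
  show "CARD('n) < card (set X)" using d l by (simp add: distinct_card)
  fix a :: "real ^ 'n" and b assume a: "a \<noteq> 0"
  let ?A = "{x. x \<bullet> a = b}" and ?I = "{i. i < length X \<and> X ! i \<in> {x. x \<bullet> a = b}}"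
  have eq: "?A = {x. a \<bullet> x = b}" by (simp add: inner_commute)
  have "affine ?A" "aff_dim ?A = int CARD('n) - 1"
    unfolding eq using a by (simp_all add: affine_hyperplane)
  then have "card ?I \<le> CARD('n)" using X unfolding general_position_def by blast
  moreover have "set X \<inter> ?A = (!) X ` ?I" by (auto simp: in_set_conv_nth)
  moreover have "card ((!) X ` ?I) \<le> card ?I" by (rule card_image_le) simp
  ultimately show "card (set X \<inter> ?A) \<le> CARD('n)" by simp
qed simp

lemma corrupted_contaminated_sample:
  fixes X :: "(real ^ 'n) list"
  assumes "gen_pos (set X)" "distinct X" "Y \<in> corrupted X c" "c \<le> length X"
    and "h \<le> length X - c" "length X + CARD('n) < 2 * h"
  shows "contaminated_sample (set X) Y (length X - c) h" "length Y = length X"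
proof -
  obtain G C where Y: "Y = G @ C" "mset G \<subseteq># mset X" "length G = length X - c" "length C = c"
    using assms(3) by (auto simp: corrupted_def)
  show len: "length Y = length X" using Y assms(4) by simp
  have sub: "set G \<subseteq> set X" using set_mset_mono[OF Y(2)] by simp
  \<comment> \<open>Completing \<open>G\<close> by \<open>Z\<close> to a permutation of
    \<open>X\<close> transfers distinctness to \<open>G\<close>.\<close>
  obtain Z where "mset Z = mset X - mset G" using ex_mset by blast
  then have "mset (G @ Z) = mset X" using Y(2) by simp
  then have "distinct G" using mset_eq_imp_distinct_iff assms(2) distinct_append by metis
  then have inj: "inj_on ((!) G) {..<length G}" by (simp add: inj_on_nth)
  have nth: "Y ! i = G ! i" if "i < length X - c" for i using that Y by (simp add: nth_append)
  have "Y ! i \<in> set X" if "i < length X - c" for i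
    using nth[OF that] that sub Y(3) by (metis nth_mem subsetD)
  moreover have "inj_on ((!) Y) {..<length X - c}"
    using inj nth Y(3) by (simp add: inj_on_def)
  ultimately show "contaminated_sample (set X) Y (length X - c) h"
    using assms len by unfold_locales auto
qed

text \<open>Holds at every contamination level, including those where the exact-fit rule applies and
  the subset may exceed \<open>h\<close> positions.\<close>

lemma pcs_subset_card:
  assumes "pcs_subset h Y H"
  shows "H \<subseteq> {..<length Y}" "h \<le> card H"
proof -
  obtain H\<^sub>0 where min: "is_arg_min (incongruence h Y) (\<lambda>H. H \<in> h_subsets (length Y) h) H\<^sub>0"
    and H: "let F = {P \<in> hyperplanes Y H\<^sub>0. h \<le> card (on_hyperplane Y P)} in
         if F = {} then H = H\<^sub>0 else H \<in> on_hyperplane Y ` F"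
    using assms unfolding pcs_subset_def by blast
  have "H\<^sub>0 \<subseteq> {..<length Y} \<and> h \<le> card H\<^sub>0"
    using min by (auto simp: is_arg_min_def h_subsets_def)
  then have "H \<subseteq> {..<length Y} \<and> h \<le> card H"
    using H unfolding Let_def by (auto simp: on_hyperplane_def split: if_splits)
  then show "H \<subseteq> {..<length Y}" "h \<le> card H" by auto
qed

text \<open>The order of quantifiers is the content: \<open>\<rho>\<close> is fixed before
  \<open>Y\<close>, \<open>g\<close> and \<open>H\<close>.\<close>

lemma pcs_norm_bound:
  fixes D :: "(real ^ 'n) set"
  assumes D: "gen_pos D"
  obtains \<rho> where "\<And>Y g H i. contaminated_sample D Y g h \<Longrightarrow> length Y = n \<Longrightarrow> pcs_subset h Y H
      \<Longrightarrow> i \<in> H \<Longrightarrow> norm (Y ! i) \<le> \<rho>"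
proof -
  obtain \<delta> M where b: "0 < \<delta>" "\<delta> \<le> 1" "1 \<le> M"
    "\<And>J x. J \<subseteq> D \<Longrightarrow> card J = CARD('n) \<Longrightarrow> x \<in> D \<Longrightarrow> sq_dist (affine hull J) x \<le> M"
    "\<And>J x. J \<subseteq> D \<Longrightarrow> card J = CARD('n) \<Longrightarrow> x \<in> D - J \<Longrightarrow> \<delta> \<le> sq_dist (affine hull J) x"
    using gen_pos_sq_dist_bounds[OF D] by metis
  have "finite D" using D by (simp add: gen_pos_def)
  then obtain B where B: "\<And>x. x \<in> D \<Longrightarrow> norm x \<le> B"
    using finite_imp_bounded bounded_iff by metis
  \<comment> \<open>\<open>dist_bound\<close> with \<open>n\<close> for \<open>length Y\<close>, so
    that it can be named before \<open>Y\<close> is introduced.\<close>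
  define E where "E = h * M * exp (2 ^ h * (ln (M * n / \<delta>) + ln h))"
  show ?thesis
  proof (rule that[of "(CARD('n) + 1) * (sqrt (E / \<delta>) * B)"])
    fix Y :: "(real ^ 'n) list" and g H i
    assume Y: "contaminated_sample D Y g h" "length Y = n" and H: "pcs_subset h Y H" and i: "i \<in> H"
    interpret contaminated_sample D Y g h by fact
    interpret contaminated_sample_bounds D Y g h \<delta> M using b by unfold_locales
    have "dist_bound = E" by (simp add: dist_bound_def E_def Y(2))
    then show "norm (Y ! i) \<le> (CARD('n) + 1) * (sqrt (E / \<delta>) * B)"
      using arg_min_norm_le[OF pcs_subset_is_arg_min[OF H] i B] by simp
  qed
qed

lemma (in contaminated_sample) pcs_scatter_ge:
  assumes H: "pcs_subset h Y H"
    and \<kappa>: "\<And>K v s. K \<subseteq> D \<Longrightarrow> CARD('n) < card K \<Longrightarrow> \<kappa> * (v \<bullet> v) \<le> (\<Sum>x\<in>K. (x \<bullet> v - s)\<^sup>2)"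
  shows "\<kappa> / h * (v \<bullet> v) \<le> v \<bullet> (scatter Y H *v v)"
proof -
  have "H \<in> h_subsets (length Y) h" using pcs_subset_is_arg_min[OF H] by (simp add: is_arg_min_def)
  note Hs = h_subsetsD[OF this]
  let ?G = "H \<inter> {..<g}"
  have "CARD('n) < card ((!) Y ` ?G)" using card_genuine[OF Hs(1)] Hs(2) genuine_image(2)[of ?G] by simp
  then have "\<kappa> / card H * (v \<bullet> v) \<le> v \<bullet> (scatter Y H *v v)"
    using genuine_image(1)[of ?G] by (intro scatter_ge[where G = ?G] Hs \<kappa> inj_on_subset[OF inj]) auto
  then show ?thesis using Hs(2) by simp
qed

text \<open>Two members far apart along \<open>v\<close> force a large variance wherever the mean
  lies.\<close>

lemma scatter_ge_pair:
  assumes "finite H" "i \<in> H" "j \<in> H" "i \<noteq> j"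
  shows "((X ! i - X ! j) \<bullet> v)\<^sup>2 / (2 * card H) \<le> v \<bullet> (scatter X H *v v)"
proof -
  define f where "f k = (X ! k - ave ((!) X) H) \<bullet> v" for k
  have "(X ! i - X ! j) \<bullet> v = f i - f j" by (simp add: f_def inner_diff_left)
  moreover have "(f i - f j)\<^sup>2 \<le> 2 * ((f i)\<^sup>2 + (f j)\<^sup>2)"
    using zero_le_power2[of "f i + f j"] by (simp add: power2_eq_square algebra_simps)
  moreover have "(f i)\<^sup>2 + (f j)\<^sup>2 \<le> (\<Sum>k\<in>H. (f k)\<^sup>2)"
    using sum_mono2[of H "{i, j}" "\<lambda>k. (f k)\<^sup>2"] assms by simp
  ultimately have "((X ! i - X ! j) \<bullet> v)\<^sup>2 / 2 \<le> (\<Sum>k\<in>H. (f k)\<^sup>2)" by simp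
  then have "((X ! i - X ! j) \<bullet> v)\<^sup>2 / 2 / card H \<le> (\<Sum>k\<in>H. (f k)\<^sup>2) / card H"
    by (intro divide_right_mono) auto
  then show ?thesis by (simp add: scatter_quadratic_form ave_real_eq f_def)
qed

section \<open>Conjugation by the inverse square root\<close>

lemma pos_def_norm_bounds:
  fixes R :: "real ^ 'n ^ 'n"
  assumes R: "pos_def R"
  obtains r\<^sub>1 r\<^sub>2 where "0 < r\<^sub>1" "0 < r\<^sub>2" "\<And>v. r\<^sub>1 * (v \<bullet> v) \<le> (R *v v) \<bullet> (R *v v)"
    "\<And>v. (R *v v) \<bullet> (R *v v) \<le> r\<^sub>2 * (v \<bullet> v)"
proof -
  have sym: "transpose R = R" using R by (simp add: pos_def_def)
  then have symRR: "transpose (R ** R) = R ** R" by (simp add: matrix_transpose_mul)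
  have RR: "v \<bullet> ((R ** R) *v v) = (R *v v) \<bullet> (R *v v)" for v
    using symmetric_inner[OF sym, of v "R *v v"] by (simp add: matrix_vector_mul_assoc)
  have pos: "0 < l" if l: "l \<in> eigenvalues (R ** R)" for l
  proof -
    obtain v where v: "v \<noteq> 0" "v \<bullet> ((R ** R) *v v) = l * (v \<bullet> v)"
      using l by (rule eigenvalue_quadratic_form)
    have "R *v v \<noteq> 0" using R v(1) unfolding pos_def_def by (metis inner_zero_right less_irrefl)
    then have "0 < l * (v \<bullet> v)" unfolding v(2)[symmetric] RR by simp
    then show ?thesis by (rule zero_less_mult_pos2) (simp add: v(1))
  qed
  show ?thesis
    using that[OF pos[OF symmetric_Min_eigenvalue(1)[OF symRR]] pos[OF symmetric_Max_eigenvalue(1)[OF symRR]]]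
      symmetric_Min_eigenvalue(2)[OF symRR] symmetric_Max_eigenvalue(2)[OF symRR] by (simp add: RR)
qed

lemma conjugate_quadratic_form:
  fixes R A :: "real ^ 'n ^ 'n"
  assumes "transpose R = R"
  shows "v \<bullet> ((R ** A ** R) *v v) = (R *v v) \<bullet> (A *v (R *v v))"
  using symmetric_inner[OF assms, of v "A *v (R *v v)"] by (simp add: matrix_vector_mul_assoc matrix_mul_assoc)

lemma transpose_conjugate:
  fixes R A :: "real ^ 'n ^ 'n"
  assumes "transpose R = R" "transpose A = A"
  shows "transpose (R ** A ** R) = R ** A ** R"
  using assms by (simp add: matrix_transpose_mul matrix_mul_assoc)

section \<open>Bias below and at the critical contamination\<close>

locale pcs_setting =
  fixes X :: "(real ^ 'p) list" and n h :: nat and S :: "(real ^ 'p) list \<Rightarrow> real ^ 'p ^ 'p"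
  assumes length_X: "length X = n" and p_ge: "2 \<le> CARD('p)" and distinct: "distinct X"
    and gen_pos_X: "gen_pos (set X)" and h_le: "h \<le> n"
    and h_gt: "n + CARD('p) < 2 * h" and S: "pcs_scatter n h S"
begin

definition R where "R = inv_sqrt (S X)"

text \<open>Makes \<open>inv_sqrt (S X)\<close> meaningful; the clean data are treated as the
  corrupted sample with \<open>c = 0\<close>.\<close>

lemma scatter_X_pos_def: "pos_def (S X)"
proof -
  have "X \<in> corrupted X 0" by (auto simp: corrupted_def)
  from corrupted_contaminated_sample(1)[OF gen_pos_X distinct this]
  interpret contaminated_sample "set X" X n h using h_le h_gt length_X by simp
  obtain H where H: "pcs_subset h X H" "S X = scatter X H"
    using S length_X unfolding pcs_scatter_def by blast
  obtain \<kappa> where \<kappa>: "0 < \<kappa>"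
    "\<And>K v s. K \<subseteq> set X \<Longrightarrow> CARD('p) < card K \<Longrightarrow> \<kappa> * (v \<bullet> v) \<le> (\<Sum>x\<in>K. (x \<bullet> v - s)\<^sup>2)"
    using gen_pos_spread_pos_uniform[OF gen_pos_X] by blast
  have "0 < v \<bullet> (scatter X H *v v)" if "v \<noteq> 0" for v
  proof -
    have "0 < \<kappa> / h * (v \<bullet> v)" using \<kappa>(1) h_pos that by simp
    also have "\<dots> \<le> v \<bullet> (scatter X H *v v)" by (rule pcs_scatter_ge[OF H(1) \<kappa>(2)])
    finally show ?thesis .
  qed
  then show ?thesis by (simp add: pos_def_def H(2) transpose_scatter)
qed

lemma R_pos_def: "pos_def R"
  unfolding R_def by (rule pos_def_inv_sqrt[OF scatter_X_pos_def])

lemma R_sym: "transpose R = R"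
  using R_pos_def by (simp add: pos_def_def)

text \<open>The spread \<open>\<kappa>\<close> bounds the form from below and the radius
  \<open>\<rho>\<close> from above. Both precede \<open>Y\<close>, so their quotient, adjusted for
  \<open>R\<close>, bounds the supremum.\<close>

lemma bias_finite:
  assumes c: "c \<le> n - h"
  shows "bias S X c \<noteq> \<infinity>"
proof -
  obtain \<kappa> where \<kappa>: "0 < \<kappa>"
    "\<And>K v s. K \<subseteq> set X \<Longrightarrow> CARD('p) < card K \<Longrightarrow> \<kappa> * (v \<bullet> v) \<le> (\<Sum>x\<in>K. (x \<bullet> v - s)\<^sup>2)"
    using gen_pos_spread_pos_uniform[OF gen_pos_X] by blast
  obtain \<rho> where \<rho>: "\<And>Y g H i. contaminated_sample (set X) Y g h \<Longrightarrow> length Y = n \<Longrightarrow> pcs_subset h Y H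
      \<Longrightarrow> i \<in> H \<Longrightarrow> norm (Y ! i) \<le> \<rho>"
    using pcs_norm_bound[OF gen_pos_X] by blast
  obtain r\<^sub>1 r\<^sub>2 where r: "0 < r\<^sub>1" "0 < r\<^sub>2" "\<And>v. r\<^sub>1 * (v \<bullet> v) \<le> (R *v v) \<bullet> (R *v v)"
    "\<And>v. (R *v v) \<bullet> (R *v v) \<le> r\<^sub>2 * (v \<bullet> v)"
    using pos_def_norm_bounds[OF R_pos_def] by blast
  have "eigen_ratio (R ** S Y ** R) \<le> ereal ((2 * \<rho>)\<^sup>2 * r\<^sub>2 / (\<kappa> / h * r\<^sub>1))" if Y: "Y \<in> corrupted X c" for Y
  proof -
    have cs: "contaminated_sample (set X) Y (n - c) h" and len: "length Y = n"
      using corrupted_contaminated_sample[OF gen_pos_X distinct Y, of h] c h_le h_gt length_X by auto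
    interpret contaminated_sample "set X" Y "n - c" h by fact
    obtain H where H: "pcs_subset h Y H" "S Y = scatter Y H"
      using S len unfolding pcs_scatter_def by blast
    have "finite H" "H \<noteq> {}" using pcs_subset_card[OF H(1)] h_pos finite_subset by auto
    show ?thesis
    proof (rule eigen_ratio_le)
      show "transpose (R ** S Y ** R) = R ** S Y ** R"
        unfolding H(2) by (rule transpose_conjugate[OF R_sym transpose_scatter])
      show "0 < \<kappa> / h * r\<^sub>1" using \<kappa> r h_pos by simp
      fix v
      have "\<kappa> / h * (r\<^sub>1 * (v \<bullet> v)) \<le> \<kappa> / h * ((R *v v) \<bullet> (R *v v))"
        using r(3)[of v] \<kappa>(1) by (intro mult_left_mono) auto
      also have "\<dots> \<le> (R *v v) \<bullet> (S Y *v (R *v v))"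
        unfolding H(2) by (rule pcs_scatter_ge[OF H(1) \<kappa>(2)])
      finally show "\<kappa> / h * r\<^sub>1 * (v \<bullet> v) \<le> v \<bullet> ((R ** S Y ** R) *v v)"
        by (simp add: conjugate_quadratic_form[OF R_sym])
      have "(R *v v) \<bullet> (scatter Y H *v (R *v v)) \<le> (2 * (\<rho> * norm (R *v v)))\<^sup>2"
      proof (rule scatter_le)
        fix i assume "i \<in> H"
        then have "norm (Y ! i) * norm (R *v v) \<le> \<rho> * norm (R *v v)"
          using \<rho>[OF cs len H(1)] by (intro mult_right_mono) auto
        then show "\<bar>Y ! i \<bullet> (R *v v)\<bar> \<le> \<rho> * norm (R *v v)"
          using Cauchy_Schwarz_ineq2[of "Y ! i" "R *v v"] by linarith
      qed fact+
      also have "\<dots> = (2 * \<rho>)\<^sup>2 * ((R *v v) \<bullet> (R *v v))"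
        by (simp add: power_mult_distrib dot_square_norm)
      also have "\<dots> \<le> (2 * \<rho>)\<^sup>2 * (r\<^sub>2 * (v \<bullet> v))"
        using r(4) by (intro mult_left_mono) auto
      finally show "v \<bullet> ((R ** S Y ** R) *v v) \<le> (2 * \<rho>)\<^sup>2 * r\<^sub>2 * (v \<bullet> v)"
        by (simp add: conjugate_quadratic_form[OF R_sym] H(2))
    qed
  qed
  then have "bias S X c \<le> ereal ((2 * \<rho>)\<^sup>2 * r\<^sub>2 / (\<kappa> / h * r\<^sub>1))"
    unfolding bias_def R_def[symmetric] by (intro SUP_least)
  then show ?thesis by auto
qed

text \<open>The contaminated rows all sit at one remote point of a line. Every admissible subset contains
  such a row and a genuine row, so the variance explodes along the line, while it stays bounded in
  any direction orthogonal to it.\<close>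
lemma bias_infinite: "bias S X (n - h + 1) = \<infinity>"
proof -
  obtain k l :: 'p where kl: "k \<noteq> l"
  proof -
    have "\<not> card (UNIV :: 'p set) \<le> Suc 0" using p_ge by simp
    then show ?thesis using that by (auto simp: card_le_Suc0_iff_eq)
  qed
  define u w :: "real ^ 'p" where "u = axis k 1" and "w = axis l 1"
  have uw: "u \<bullet> u = 1" "w \<bullet> w = 1" "u \<bullet> w = 0" "norm u = 1" "norm w = 1"
    using kl by (simp_all add: u_def w_def inner_axis_axis)
  have "finite (set X)" by simp
  then obtain B where B: "0 < B" "\<And>x. x \<in> set X \<Longrightarrow> norm x \<le> B"
    using finite_imp_bounded bounded_pos by metis
  obtain r\<^sub>1 r\<^sub>2 where r: "0 < r\<^sub>1" "0 < r\<^sub>2" "\<And>v. r\<^sub>1 * (v \<bullet> v) \<le> (R *v v) \<bullet> (R *v v)"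
    "\<And>v. (R *v v) \<bullet> (R *v v) \<le> r\<^sub>2 * (v \<bullet> v)"
    using pos_def_norm_bounds[OF R_pos_def] by blast
  \<comment> \<open>Preimages under \<open>R\<close>: the form of the conjugated matrix at
    \<open>u'\<close> is that of \<open>S Y\<close> at \<open>u\<close>, and likewise for
    \<open>w'\<close>.\<close>
  define u' w' where "u' = matrix_inv R *v u" and "w' = matrix_inv R *v w"
  have "R ** matrix_inv R = mat 1" using pos_def_invertible[OF R_pos_def] 
    unfolding matrix_inv_def invertible_def by (auto intro: someI2_ex)
  then have Ru: "R *v u' = u" "R *v w' = w" by (simp_all add: u'_def w'_def matrix_vector_mul_assoc)
  then have nz: "u' \<noteq> 0" "w' \<noteq> 0" using uw by auto
  \<comment> \<open>The \<open>h - 1\<close> genuine and the \<open>n - h + 1\<close> planted rows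
    are each too few to fill an admissible subset.\<close>
  have h: "h - 1 < h" "h \<le> n" "n - h + 1 < h" using h_le h_gt p_ge by linarith+
  have "\<exists>Y\<in>corrupted X (n - h + 1). ereal (real m) \<le> eigen_ratio (R ** S Y ** R)" for m :: nat
  proof -
    \<comment> \<open>Chosen so that \<open>K\<close> times the constant factor of the final
      quotient is exactly \<open>m\<close>; the true quotient has the larger square of
      \<open>K + 1\<close> instead.\<close>
    define K where "K = m * ((2 * B)\<^sup>2 * r\<^sub>2) * (2 * n) / r\<^sub>1"
    have K: "0 \<le> K" using r by (simp add: K_def)
    \<comment> \<open>\<open>B\<close> absorbs the projection of a genuine row, leaving a gap of at
      least \<open>K + 1\<close> along \<open>u\<close>.\<close>
    define N where "N = B + (K + 1)"
    define Y where "Y = take (h - 1) X @ replicate (n - h + 1) (N *\<^sub>R u)"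
    have "mset (take (h - 1) X) \<subseteq># mset X"
      by (metis append_take_drop_id mset_append mset_subset_eq_add_left)
    moreover have "length (take (h - 1) X) = length X - (n - h + 1)"
      using length_X h by simp
    ultimately have Y: "Y \<in> corrupted X (n - h + 1)"
      unfolding corrupted_def Y_def mem_Collect_eq
      by (intro exI[of _ "take (h - 1) X"] exI[of _ "replicate (n - h + 1) (N *\<^sub>R u)"]) simp
    have len: "length Y = n" using length_X h by (simp add: Y_def)
    have genuine: "norm (Y ! i) \<le> B" if "i < h - 1" for i
      using that h length_X by (simp add: Y_def nth_append B(2))
    have planted: "Y ! i = N *\<^sub>R u" if "h - 1 \<le> i" "i < n" for i
      using that h length_X by (auto simp: Y_def nth_append simp del: replicate_Suc)
    obtain H where H: "pcs_subset h Y H" "S Y = scatter Y H"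
      using S len unfolding pcs_scatter_def by blast
    have Hn: "H \<subseteq> {..<n}" "h \<le> card H" using pcs_subset_card[OF H(1)] len by auto
    have fin: "finite H" using Hn(1) finite_subset by blast
    have ne: "H \<noteq> {}" using Hn(2) h by auto
    have card_H: "card H \<le> n" using card_mono[OF _ Hn(1)] by simp
    obtain i where i: "i \<in> H" "i < h - 1"
    proof -
      have "\<not> H \<subseteq> {h - 1..<n}"
      proof
        assume "H \<subseteq> {h - 1..<n}"
        from card_mono[OF _ this] show False using Hn(2) h by simp
      qed
      then show ?thesis using that Hn(1) by force
    qed
    obtain j where j: "j \<in> H" "h - 1 \<le> j"
    proof -
      have "\<not> H \<subseteq> {..<h - 1}"
      proof
        assume "H \<subseteq> {..<h - 1}"
        from card_mono[OF _ this] show False using Hn(2) h by simp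
      qed
      then show ?thesis using that by force
    qed
    have bw: "w \<bullet> (scatter Y H *v w) \<le> (2 * B)\<^sup>2"
    proof (rule scatter_le[OF fin ne])
      fix i assume "i \<in> H"
      show "\<bar>Y ! i \<bullet> w\<bar> \<le> B"
      proof (cases "i < h - 1")
        case True
        then show ?thesis
          using Cauchy_Schwarz_ineq2[of "Y ! i" w] genuine[OF True] uw by simp
      next
        case False
        then show ?thesis using planted[of i] \<open>i \<in> H\<close> Hn(1) uw B(1) by auto
      qed
    qed
    have bu: "(K + 1)\<^sup>2 / (2 * n) \<le> u \<bullet> (scatter Y H *v u)"
    proof -
      have "Y ! i \<bullet> u \<le> B" using Cauchy_Schwarz_ineq2[of "Y ! i" u] genuine[OF i(2)] uw by simp
      moreover have "Y ! j \<bullet> u = N" using planted[OF j(2)] j(1) Hn(1) uw by auto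
      ultimately have "K + 1 \<le> (Y ! j - Y ! i) \<bullet> u" by (simp add: inner_diff_left N_def)
      then have "(K + 1)\<^sup>2 \<le> ((Y ! j - Y ! i) \<bullet> u)\<^sup>2" using K by (intro power_mono) auto
      moreover have "0 < card H" using fin ne by (simp add: card_gt_0_iff)
      ultimately have "(K + 1)\<^sup>2 / (2 * n) \<le> ((Y ! j - Y ! i) \<bullet> u)\<^sup>2 / (2 * card H)"
        using card_H by (intro frac_le) auto
      also have "\<dots> \<le> u \<bullet> (scatter Y H *v u)" using i j by (intro scatter_ge_pair[OF fin]) auto
      finally show ?thesis .
    qed
    let ?a = "(K + 1)\<^sup>2 / (2 * n) * r\<^sub>1" and ?b = "(2 * B)\<^sup>2 * r\<^sub>2"
    have "ereal (?a / ?b) \<le> eigen_ratio (R ** S Y ** R)"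
    proof (rule eigen_ratio_ge[OF _ _ nz(1) _ nz(2)])
      show "transpose (R ** S Y ** R) = R ** S Y ** R"
        unfolding H(2) by (rule transpose_conjugate[OF R_sym transpose_scatter])
      show "0 \<le> v \<bullet> ((R ** S Y ** R) *v v)" for v
        by (simp add: conjugate_quadratic_form[OF R_sym] H(2) scatter_psd)
      have "(K + 1)\<^sup>2 / (2 * n) * (r\<^sub>1 * (u' \<bullet> u')) \<le> (K + 1)\<^sup>2 / (2 * n) * 1"
        using r(3)[of u'] Ru uw by (intro mult_left_mono) auto
      then show "?a * (u' \<bullet> u') \<le> u' \<bullet> ((R ** S Y ** R) *v u')"
        using bu by (simp add: conjugate_quadratic_form[OF R_sym] H(2) Ru mult.assoc)
      have "(2 * B)\<^sup>2 * 1 \<le> (2 * B)\<^sup>2 * (r\<^sub>2 * (w' \<bullet> w'))"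
        using r(4)[of w'] Ru uw by (intro mult_left_mono) auto
      then show "w' \<bullet> ((R ** S Y ** R) *v w') \<le> ?b * (w' \<bullet> w')"
        using bw by (simp add: conjugate_quadratic_form[OF R_sym] H(2) Ru mult.assoc)
      show "0 \<le> ?a" using r by simp
    qed
    moreover have "m \<le> ?a / ?b"
    proof -
      have "K * 1 \<le> (K + 1) * (K + 1)" using K by (intro mult_mono) auto
      then have "K \<le> (K + 1)\<^sup>2" by (simp add: power2_eq_square)
      moreover have "0 < r\<^sub>1 / (2 * n * ?b)" using r h B(1) by simp
      ultimately have "K * (r\<^sub>1 / (2 * n * ?b)) \<le> (K + 1)\<^sup>2 * (r\<^sub>1 / (2 * n * ?b))"
        by (intro mult_right_mono) auto
      moreover have "K * (r\<^sub>1 / (2 * n * ?b)) = m" using r h B(1) by (simp add: K_def)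
      ultimately show ?thesis by (simp add: mult.assoc)
    qed
    ultimately have "ereal m \<le> eigen_ratio (R ** S Y ** R)"
      by (meson ereal_less_eq(3) order_trans)
    then show ?thesis using Y by blast
  qed
  then show ?thesis unfolding bias_def R_def[symmetric] by (intro SUP_PInfty)
qed

lemma breakdown_point_eq: "breakdown_point S X = real (n - h + 1) / real n"
  unfolding breakdown_point_def length_X
proof (rule Min_eqI)
  let ?A = "{real c / real n |c. 1 \<le> c \<and> c \<le> n \<and> bias S X c = \<infinity>}"
  have "?A \<subseteq> (\<lambda>c. real c / real n) ` {..n}" by auto
  then show "finite ?A" by (rule finite_subset) simp
  have "n - h + 1 \<le> n" using h_le h_gt by simp
  then show "real (n - h + 1) / real n \<in> ?A" using bias_infinite by fastforce
  fix y assume "y \<in> ?A"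
  then obtain c where c: "y = real c / real n" "bias S X c = \<infinity>" by auto
  then have "n - h + 1 \<le> c" using bias_finite[of c] by fastforce
  then show "real (n - h + 1) / real n \<le> y" unfolding c(1) by (intro divide_right_mono) auto
qed

end

theorem theorem1:
  fixes X :: "(real ^ 'p) list"
    and S :: "(real ^ 'p) list \<Rightarrow> real ^ 'p ^ 'p"
    and n h :: nat
  assumes "length X = n"
    and "n > CARD('p) + 1" and "CARD('p) + 1 > 2"
    and "h = nat \<lceil>(real n + real CARD('p) + 1) / 2\<rceil>"
    and "general_position X"
    and "bdd_above {(x \<bullet> a / norm a)\<^sup>2 | x a. x \<in> set X \<and> a \<noteq> 0}"
    and "\<And>i j. i < j \<Longrightarrow> j < n \<Longrightarrow> norm (X ! i - X ! j) > 0"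
    and "pcs_scatter n h S"
  shows "breakdown_point S X = real (n - h + 1) / real n"
proof -
  have "X ! i \<noteq> X ! j" if "i < n" "j < n" "i \<noteq> j" for i j
    using assms(7)[of i j] assms(7)[of j i] that by (cases "i < j") auto
  then have d: "distinct X" using assms(1) by (simp add: distinct_conv_nth)
  have "(real n + real CARD('p) + 1) / 2 \<le> real h"
    unfolding assms(4) by (rule real_nat_ceiling_ge)
  then have "real (n + CARD('p) + 1) \<le> real (2 * h)" by simp
  then have h_gt: "n + CARD('p) < 2 * h" unfolding of_nat_le_iff by linarith
  \<comment> \<open>Equivalent to \<open>(n + p + 1) / 2 \<le> n\<close>, and the ceiling cannot
    pass the integer \<open>n\<close>.\<close>
  have "real (CARD('p) + 1) \<le> real n" using assms(2) unfolding of_nat_le_iff by simp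
  then have h_le: "h \<le> n" unfolding assms(4) nat_ceiling_le_eq by simp
  have "pcs_setting X n h S"
    using assms(1-3,8) d h_gt h_le gen_pos_set[OF assms(5) d] by unfold_locales auto
  then show ?thesis by (rule pcs_setting.breakdown_point_eq)
qed

end
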